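(* Let $\eta$ be the standard Gaussian measure on $\mathbb{R}^d$ and let $F,G:\mathbb{R}^d\to\mathbb{R}^d$ be invertible lower-triangular maps with components $F_i,G_i$. Suppose: (D1) $F_i,G_i\in V_{\eta_{\le i}}(\mathbb{R}^i;\mathbb{R})$ for $i=1,\dots,d$; (D2) there exists a constant $c>0$ such that $\partial_{x_i}F_i,\ \partial_{x_i}G_i>c>0$ $\eta$-a.e. in $\mathbb{R}^d$ (for $i=1,\dots,d$); (D3) there exists a constant $c_F<\infty$ such that $p_{F^\sharp\eta}(x)\le c_F\,p_\eta(x)$ for all $x\in\mathbb{R}^d$. Then $$\mathrm{KL}(F^\sharp\eta\,\|\,G^\sharp\eta)\le C\sum_{i=1}^d\|F_i-G_i\|_{V_{\eta_{\le i}}(\mathbb{R}^i;\mathbb{R})},$$ where the constant $C>0$ depends only on $c_F$, $c$ and $\|F+G\|_{L^2_\eta}$.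
   Context: A map $T:\mathbb{R}^d\to\mathbb{R}^d$ is lower-triangular if $T(x)=(T_1(x_1),T_2(x_1,x_2),\dots,T_d(x_1,\dots,x_d))$. $\eta_{\le i}$ is the marginal of $\eta$ on the first $i$ coordinates. $V_{\eta_{\le i}}(\mathbb{R}^i;\mathbb{R})$ is the space of $v\in L^2_{\eta_{\le i}}(\mathbb{R}^i;\mathbb{R})$ with finite norm $\|v\|_{V_{\eta_{\le i}}(\mathbb{R}^i;\mathbb{R})}=\big(\|v\|^2_{L^2_{\eta_{\le i}}(\mathbb{R}^i;\mathbb{R})}+\int_{\mathbb{R}^i}|\partial_i v|^2\,d\eta_{\le i}\big)^{1/2}$. $F^\sharp\eta:=(F^{-1})_\sharp\eta$ is the pullback; $p_\mu$ denotes the Lebesgue density of $\mu$. For absolutely continuous probability measures, $\mathrm{KL}(\mu\|\mu')=\int\log\big(p_\mu(x)/p_{\mu'}(x)\big)\,p_\mu(x)\,dx$. $\|f\|_{L^2_\eta}=(\int|f|^2\,d\eta)^{1/2}$. *)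

theory Defs
  imports "HOL-Probability.Probability"
begin

text \<open>
  Points of \<open>\<real>\<^sup>n\<close> are the extensional functions on \<open>{1..n}\<close>, so that the dimension can be
  quantified over inside a formula and \<open>\<real>\<^sup>i\<close> and \<open>\<real>\<^sup>d\<close> occur side by side. The projection of
  \<open>x\<close> onto its first \<open>i\<close> coordinates is \<^term>\<open>restrict x {1..i}\<close>.
\<close>

definition Rn :: "nat \<Rightarrow> (nat \<Rightarrow> real) set" where
  "Rn n = PiE {1..n} (\<lambda>_. UNIV)"

definition lebesgue_Rn :: "nat \<Rightarrow> (nat \<Rightarrow> real) measure" where
  "lebesgue_Rn n = PiM {1..n} (\<lambda>_. lborel)"

definition std_gaussian :: "nat \<Rightarrow> (nat \<Rightarrow> real) measure" where
  "std_gaussian n = PiM {1..n} (\<lambda>_. density lborel (\<lambda>t. ennreal (std_normal_density t)))"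

definition marginal :: "nat \<Rightarrow> (nat \<Rightarrow> real) measure \<Rightarrow> (nat \<Rightarrow> real) measure" where
  "marginal i \<mu> = distr \<mu> (lebesgue_Rn i) (\<lambda>x. restrict x {1..i})"


subsection \<open>Weak partial derivatives\<close>

definition pd :: "nat \<Rightarrow> ((nat \<Rightarrow> real) \<Rightarrow> real) \<Rightarrow> (nat \<Rightarrow> real) \<Rightarrow> real" where
  "pd k \<phi> x = deriv (\<lambda>t. \<phi> (x(k := t))) (x k)"

fun iter_pd :: "nat list \<Rightarrow> ((nat \<Rightarrow> real) \<Rightarrow> real) \<Rightarrow> (nat \<Rightarrow> real) \<Rightarrow> real" where
  "iter_pd [] \<phi> = \<phi>"
| "iter_pd (k # ks) \<phi> = pd k (iter_pd ks \<phi>)"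

text \<open>\<open>C\<^sup>\<infinity>\<close>: all iterated partial derivatives exist and are continuous. Existence has to be required
  separately because \<^const>\<open>deriv\<close> is total.\<close>

definition smooth_Rn :: "nat \<Rightarrow> ((nat \<Rightarrow> real) \<Rightarrow> real) \<Rightarrow> bool" where
  "smooth_Rn n \<phi> \<longleftrightarrow> (\<forall>ks \<in> lists {1..n}.
     continuous_map (powertop_real {1..n}) euclideanreal (iter_pd ks \<phi>) \<and>
     (\<forall>k \<in> {1..n}. \<forall>x \<in> Rn n. (\<lambda>t. iter_pd ks \<phi> (x(k := t))) differentiable (at (x k))))"

text \<open>Every compact subset of \<open>\<real>\<^sup>n\<close> lies in a cube, and cubes are compact; so cubes suffice to
  express compact support and local integrability.\<close>

definition cube :: "nat \<Rightarrow> real \<Rightarrow> (nat \<Rightarrow> real) set" where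
  "cube n r = PiE {1..n} (\<lambda>_. {-r..r})"

definition test_function :: "nat \<Rightarrow> ((nat \<Rightarrow> real) \<Rightarrow> real) \<Rightarrow> bool" where
  "test_function n \<phi> \<longleftrightarrow> smooth_Rn n \<phi> \<and> (\<exists>r. \<forall>x \<in> Rn n - cube n r. \<phi> x = 0)"

definition locally_integrable :: "nat \<Rightarrow> ((nat \<Rightarrow> real) \<Rightarrow> real) \<Rightarrow> bool" where
  "locally_integrable n v \<longleftrightarrow> (\<forall>r. set_integrable (lebesgue_Rn n) (cube n r) v)"

definition has_weak_pd ::
  "nat \<Rightarrow> nat \<Rightarrow> ((nat \<Rightarrow> real) \<Rightarrow> real) \<Rightarrow> ((nat \<Rightarrow> real) \<Rightarrow> real) \<Rightarrow> bool" where
  "has_weak_pd n k v g \<longleftrightarrow> locally_integrable n v \<and> locally_integrable n g \<and>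
     (\<forall>\<phi>. test_function n \<phi> \<longrightarrow>
        (\<integral>x. v x * pd k \<phi> x \<partial>lebesgue_Rn n) = - (\<integral>x. g x * \<phi> x \<partial>lebesgue_Rn n))"

text \<open>A version of the weak derivative; it is determined up to Lebesgue-null sets only.\<close>

definition weak_pd ::
  "nat \<Rightarrow> nat \<Rightarrow> ((nat \<Rightarrow> real) \<Rightarrow> real) \<Rightarrow> (nat \<Rightarrow> real) \<Rightarrow> real" where
  "weak_pd n k v = (SOME g. has_weak_pd n k v g)"


subsection \<open>Function spaces\<close>

definition L2_space :: "(nat \<Rightarrow> real) measure \<Rightarrow> ((nat \<Rightarrow> real) \<Rightarrow> real) set" where
  "L2_space \<mu> = {v \<in> borel_measurable \<mu>. integrable \<mu> (\<lambda>x. \<bar>v x\<bar>\<^sup>2)}"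

definition L2_norm :: "(nat \<Rightarrow> real) measure \<Rightarrow> ((nat \<Rightarrow> real) \<Rightarrow> real) \<Rightarrow> real" where
  "L2_norm \<mu> v = sqrt (\<integral>x. \<bar>v x\<bar>\<^sup>2 \<partial>\<mu>)"

text \<open>The \<open>L\<^sup>2\<close> norm of an \<open>\<real>\<^sup>d\<close>-valued map; the integrand is its squared Euclidean norm.\<close>

definition L2_norm_vec ::
  "nat \<Rightarrow> (nat \<Rightarrow> real) measure \<Rightarrow> ((nat \<Rightarrow> real) \<Rightarrow> (nat \<Rightarrow> real)) \<Rightarrow> real" where
  "L2_norm_vec d \<mu> T = sqrt (\<integral>x. (\<Sum>i = 1..d. (T x i)\<^sup>2) \<partial>\<mu>)"

text \<open>\<open>\<mu>\<close> is a measure on \<open>\<real>\<^sup>i\<close>; only the derivative in the last variable enters.\<close>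

definition V_space :: "nat \<Rightarrow> (nat \<Rightarrow> real) measure \<Rightarrow> ((nat \<Rightarrow> real) \<Rightarrow> real) set" where
  "V_space i \<mu> = {v \<in> L2_space \<mu>. (\<exists>g. has_weak_pd i i v g) \<and> weak_pd i i v \<in> L2_space \<mu>}"

definition V_norm :: "nat \<Rightarrow> (nat \<Rightarrow> real) measure \<Rightarrow> ((nat \<Rightarrow> real) \<Rightarrow> real) \<Rightarrow> real" where
  "V_norm i \<mu> v = sqrt ((L2_norm \<mu> v)\<^sup>2 + (\<integral>x. \<bar>weak_pd i i v x\<bar>\<^sup>2 \<partial>\<mu>))"


subsection \<open>Triangular maps, pullbacks, Kullback--Leibler divergence\<close>

definition lower_triangular ::
  "nat \<Rightarrow> ((nat \<Rightarrow> real) \<Rightarrow> (nat \<Rightarrow> real)) \<Rightarrow> (nat \<Rightarrow> (nat \<Rightarrow> real) \<Rightarrow> real) \<Rightarrow> bool" where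
  "lower_triangular d T Ti \<longleftrightarrow>
     (\<forall>x \<in> Rn d. T x = (\<lambda>i\<in>{1..d}. Ti i (restrict x {1..i})))"

text \<open>Measurability of the inverse is what makes the pullback \<open>(F\<^sup>-\<^sup>1)\<^sub>\<sharp>\<eta>\<close> meaningful. It is no extra
  restriction: by the Lusin--Souslin theorem a Borel bijection of \<open>\<real>\<^sup>d\<close> has a Borel inverse.\<close>

definition invertible_map :: "nat \<Rightarrow> ((nat \<Rightarrow> real) \<Rightarrow> (nat \<Rightarrow> real)) \<Rightarrow> bool" where
  "invertible_map d F \<longleftrightarrow> bij_betw F (Rn d) (Rn d) \<and>
     F \<in> measurable (lebesgue_Rn d) (lebesgue_Rn d) \<and>
     the_inv_into (Rn d) F \<in> measurable (lebesgue_Rn d) (lebesgue_Rn d)"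

definition pullback ::
  "nat \<Rightarrow> ((nat \<Rightarrow> real) \<Rightarrow> (nat \<Rightarrow> real)) \<Rightarrow> (nat \<Rightarrow> real) measure \<Rightarrow> (nat \<Rightarrow> real) measure" where
  "pullback d F \<mu> = distr \<mu> (lebesgue_Rn d) (the_inv_into (Rn d) F)"

definition leb_density :: "nat \<Rightarrow> (nat \<Rightarrow> real) measure \<Rightarrow> (nat \<Rightarrow> real) \<Rightarrow> real" where
  "leb_density d \<mu> x = enn2real (RN_deriv (lebesgue_Rn d) \<mu> x)"

text \<open>The integrand \<open>log(p/q) p\<close> with the usual conventions \<open>0 log(0/q) = 0\<close> and
  \<open>p log(p/0) = \<infinity>\<close> for \<open>p > 0\<close>; the real functions of the library would give \<open>p ln(p/0) = 0\<close>.\<close>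

definition kl_integrand :: "real \<Rightarrow> real \<Rightarrow> ereal" where
  "kl_integrand p q = (if p = 0 then 0 else if q = 0 then \<infinity> else ereal (ln (p / q) * p))"

text \<open>The extended-real Lebesgue integral (positive minus negative part) is used instead of the Bochner
  integral, which is 0 for non-integrable functions. For measures without Lebesgue density the value
  is set to \<open>\<infinity>\<close>, so a finite bound entails that both densities exist.\<close>

definition KL :: "nat \<Rightarrow> (nat \<Rightarrow> real) measure \<Rightarrow> (nat \<Rightarrow> real) measure \<Rightarrow> ereal" where
  "KL d \<mu> \<mu>' =
     (if absolutely_continuous (lebesgue_Rn d) \<mu> \<and> absolutely_continuous (lebesgue_Rn d) \<mu>'
      then enn2ereal (\<integral>\<^sup>+x. e2ennreal
             (kl_integrand (leb_density d \<mu> x) (leb_density d \<mu>' x)) \<partial>lebesgue_Rn d)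
         - enn2ereal (\<integral>\<^sup>+x. e2ennreal
             (- kl_integrand (leb_density d \<mu> x) (leb_density d \<mu>' x)) \<partial>lebesgue_Rn d)
      else \<infinity>)"

end

theory Submission
  imports Defs
begin

text \<open>
The pullback densities are \<open>p(x) = \<gamma>(F x) \<Prod>\<^sub>i f\<^sub>i\<close> and \<open>q(x) = \<gamma>(G x) \<Prod>\<^sub>i g\<^sub>i\<close>, where \<open>\<gamma>\<close> is the Gaussian
density and \<open>f\<^sub>i\<close>, \<open>g\<^sub>i\<close> are the weak derivatives of \<open>F\<^sub>i\<close>, \<open>G\<^sub>i\<close> in their last variable. Hence
\<open>ln (p/q) = \<Sum>\<^sub>i (G\<^sub>i\<^sup>2 - F\<^sub>i\<^sup>2)/2 + ln f\<^sub>i - ln g\<^sub>i\<close>, and since both slopes exceed \<open>c\<close>, the absolute value of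
this is at most \<open>\<Sum>\<^sub>i \<bar>F\<^sub>i - G\<^sub>i\<bar> \<bar>F\<^sub>i + G\<^sub>i\<bar>/2 + \<bar>f\<^sub>i - g\<^sub>i\<bar>/c\<close>. The density bound \<open>p \<le> c\<^sub>F \<gamma>\<close> replaces
integration against \<open>p\<close> by integration against the Gaussian, and the Cauchy--Schwarz inequality gives the
claim with the constant \<open>\<bar>c\<^sub>F\<bar> (\<parallel>F + G\<parallel>/2 + 1/c)\<close>; this is \<open>KL_pullback_le\<close>.

The substance is the formula for the densities. Only the derivative of \<open>F\<^sub>i\<close> in its last variable is known to exist,
and only weakly, so no Jacobian theorem for smooth or Lipschitz maps applies. The identity needed is
\<open>\<integral> f(F x) \<Prod>\<^sub>i f\<^sub>i dx = \<integral> f(y) dy\<close> for nonnegative measurable \<open>f\<close>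
(\<open>nn_integral_triangular_substitution\<close>): applied to \<open>f = (indicator of A \<circ> F\<^sup>-\<^sup>1) \<gamma>\<close> it yields the density of
the pullback, and because the inverse enters only through \<open>f\<close>, nothing has to be known about the exceptional
null sets of \<open>F\<close>. By Tonelli's theorem and induction on the dimension it reduces to the line, where an
absolutely continuous function with slope above \<open>c\<close> is an increasing homeomorphism that carries the measure
\<open>u' dt\<close> to Lebesgue measure (\<open>nn_integral_substitution_primitive\<close>).

It remains to know that almost every slice \<open>t \<mapsto> F\<^sub>i(x, t)\<close> agrees almost everywhere with a primitive of
\<open>f\<^sub>i(x, \<cdot>)\<close> (\<open>AE_slice_eq_primitive\<close>). Testing the weak derivative with products \<open>\<theta>(x) \<phi>(t)\<close> of smooth bumps
shows that for each fixed \<open>\<phi>\<close> almost every slice satisfies the one-dimensional weak equation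
(\<open>AE_slice_weak_derivative\<close>); countably many \<open>\<phi>\<close> suffice for the one-dimensional lemma of du Bois-Reymond
(\<open>AE_eq_primitive_if_weak_derivative\<close>). Both steps rest on \<open>AE_zero_if_orthogonal_to_bumps\<close>, which also
makes weak derivatives unique and so identifies the weak derivative of \<open>F\<^sub>i - G\<^sub>i\<close> in the norm.
\<close>

section \<open>Smooth bump functions on the line\<close>

text \<open>
For \<open>p = 1\<close> this is the classical function \<open>exp (-1/t)\<close> that is flat at the origin. The polynomial factor in
\<open>1/t\<close> makes the family closed under differentiation.
\<close>

definition flat :: "real poly \<Rightarrow> real \<Rightarrow> real" where
  "flat p t = (if t > 0 then poly p (inverse t) * exp (- inverse t) else 0)"

text \<open>
All one-sided derivatives at the origin vanish because the exponential beats every power of \<open>1/t\<close>.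
\<close>

lemma poly_times_exp_tendsto_0:
  fixes p :: "real poly"
  shows "((\<lambda>t. poly p (inverse t) * exp (- inverse t)) \<longlongrightarrow> 0) (at_right 0)"
proof -
  have "((\<lambda>x. poly p x * exp (-x)) \<longlongrightarrow> 0) at_top"
  proof (induction p)
    case 0
    then show ?case by simp
  next
    case (pCons a p)
    have mono: "((\<lambda>x. poly q x * x ^ k * exp (- x)) \<longlongrightarrow> 0) at_top" for q :: "real poly" and k
    proof (induction q arbitrary: k)
      case 0
      then show ?case by simp
    next
      case (pCons a q)
      have "((\<lambda>x::real. x ^ k * exp (- x)) \<longlongrightarrow> 0) at_top"
        using tendsto_power_div_exp_0[of k] by (simp add: exp_minus field_simps)
      from tendsto_add[OF tendsto_mult_left[OF this, of a] pCons.IH[of "Suc k"]]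
      show ?case by (simp add: algebra_simps)
    qed
    from mono[of "pCons a p" 0] show ?case by simp
  qed
  then show ?thesis
    by (rule filterlim_compose) (rule filterlim_inverse_at_top_right)
qed

lemma flat_has_derivative:
  "(flat p has_real_derivative flat (monom 1 2 * (p - pderiv p)) t) (at t)"
proof -
  consider "t > 0" | "t < 0" | "t = 0" by linarith
  then show ?thesis
  proof cases
    case 1
    have "((\<lambda>t. poly p (inverse t) * exp (- inverse t)) has_real_derivative
        flat (monom 1 2 * (p - pderiv p)) t) (at t)"
      using 1 unfolding flat_def
      by (auto intro!: derivative_eq_intros poly_DERIV[THEN DERIV_chain2]
          simp: poly_monom power2_eq_square algebra_simps)
    then show ?thesis
      by (rule has_field_derivative_transform_within_open[of _ _ _ "{0<..}"])
        (use 1 in \<open>auto simp: flat_def\<close>)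
  next
    case 2
    have "((\<lambda>_. 0) has_real_derivative 0) (at t)" by simp
    then have "(flat p has_real_derivative 0) (at t)"
      by (rule has_field_derivative_transform_within_open[of _ _ _ "{..<0}"])
        (use 2 in \<open>auto simp: flat_def\<close>)
    then show ?thesis using 2 by (simp add: flat_def)
  next
    case 3
    have right: "((\<lambda>h. flat p h / h) \<longlongrightarrow> 0) (at_right 0)"
    proof (rule Lim_transform_eventually[OF poly_times_exp_tendsto_0[of "pCons 0 p"]])
      show "\<forall>\<^sub>F h in at_right 0. poly (pCons 0 p) (inverse h) * exp (- inverse h) = flat p h / h"
        by (rule eventually_at_right_less[THEN eventually_mono]) (simp add: flat_def field_simps)
    qed
    have left: "((\<lambda>h. flat p h / h) \<longlongrightarrow> 0) (at_left 0)"
      by (rule tendsto_eventually, rule eventually_at_leftI[of "-1"]) (auto simp: flat_def)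
    have "((\<lambda>h. flat p h / h) \<longlongrightarrow> 0) (at 0)"
      using left right by (simp add: filterlim_at_split)
    then show ?thesis
      using 3 by (simp add: DERIV_def flat_def)
  qed
qed

text \<open>
Smoothness is encoded as membership in a class that is visibly closed under differentiation, which spares the
calculus of iterated derivatives. The rule for antiderivatives keeps the class closed: their derivative is a
member by assumption.
\<close>

inductive smooth_fun :: "(real \<Rightarrow> real) \<Rightarrow> bool" where
  flat: "smooth_fun (\<lambda>t. flat p (k * t + l))"
| const: "smooth_fun (\<lambda>t. a)"
| add: "smooth_fun f \<Longrightarrow> smooth_fun g \<Longrightarrow> smooth_fun (\<lambda>t. f t + g t)"
| mult: "smooth_fun f \<Longrightarrow> smooth_fun g \<Longrightarrow> smooth_fun (\<lambda>t. f t * g t)"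
| antideriv: "(\<And>t. (F has_real_derivative f t) (at t)) \<Longrightarrow> smooth_fun f \<Longrightarrow> smooth_fun F"

lemma smooth_fun_has_derivative:
  assumes "smooth_fun f"
  shows "\<exists>f'. smooth_fun f' \<and> (\<forall>t. (f has_real_derivative f' t) (at t))"
  using assms
proof induction
  case (flat p k l)
  have "((\<lambda>t. flat p (k * t + l)) has_real_derivative k * flat (monom 1 2 * (p - pderiv p)) (k * t + l)) (at t)" for t
  proof -
    have "((\<lambda>t. k * t + l) has_real_derivative k) (at t)"
      by (auto intro!: derivative_eq_intros)
    from DERIV_chain2[OF flat_has_derivative this] show ?thesis by (simp add: mult.commute)
  qed
  moreover have "smooth_fun (\<lambda>t. k * flat (monom 1 2 * (p - pderiv p)) (k * t + l))"
    by (intro smooth_fun.intros)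
  ultimately show ?case by blast
next
  case (const a)
  then show ?case by (intro exI[of _ "\<lambda>_. 0"]) (auto intro: smooth_fun.intros)
next
  case (add f g)
  then obtain f' g' where "smooth_fun f'" "smooth_fun g'"
    "\<And>t. (f has_real_derivative f' t) (at t)" "\<And>t. (g has_real_derivative g' t) (at t)" by blast
  then show ?case
    by (intro exI[of _ "\<lambda>t. f' t + g' t"]) (auto intro!: smooth_fun.add derivative_intros)
next
  case (mult f g)
  then obtain f' g' where *: "smooth_fun f'" "smooth_fun g'"
    "\<And>t. (f has_real_derivative f' t) (at t)" "\<And>t. (g has_real_derivative g' t) (at t)" by blast
  then show ?case using mult.hyps
    by (intro exI[of _ "\<lambda>t. f' t * g t + g' t * f t"])
       (auto intro!: smooth_fun.add smooth_fun.mult DERIV_mult)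
next
  case (antideriv F f)
  then show ?case by blast
qed

lemma smooth_fun_deriv:
  assumes "smooth_fun f"
  shows "smooth_fun (deriv f)" "(f has_real_derivative deriv f t) (at t)"
proof -
  obtain f' where f': "smooth_fun f'" "\<And>t. (f has_real_derivative f' t) (at t)"
    using smooth_fun_has_derivative[OF assms] by blast
  then have "deriv f = f'" by (auto intro: DERIV_imp_deriv)
  with f' show "smooth_fun (deriv f)" "(f has_real_derivative deriv f t) (at t)" by auto
qed

lemma smooth_fun_continuous: "smooth_fun f \<Longrightarrow> continuous_on A f"
  by (meson DERIV_continuous_on has_field_derivative_at_within smooth_fun_deriv(2))

lemma smooth_fun_measurable: "smooth_fun f \<Longrightarrow> f \<in> borel_measurable borel"
  by (intro borel_measurable_continuous_onI smooth_fun_continuous)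

definition bump_on :: "real \<Rightarrow> (real \<Rightarrow> real) \<Rightarrow> bool" where
  "bump_on r f \<longleftrightarrow> smooth_fun f \<and> (\<forall>t. f t \<noteq> 0 \<longrightarrow> \<bar>t\<bar> \<le> r)"

lemma bump_on_mono: "bump_on r f \<Longrightarrow> r \<le> s \<Longrightarrow> bump_on s f"
  by (force simp: bump_on_def)

lemma bump_on_deriv: "bump_on r f \<Longrightarrow> bump_on r (deriv f)"
  unfolding bump_on_def
proof safe
  fix t assume f: "smooth_fun f" "\<forall>t. f t \<noteq> 0 \<longrightarrow> \<bar>t\<bar> \<le> r" and t: "deriv f t \<noteq> 0"
  show "\<bar>t\<bar> \<le> r"
  proof (rule ccontr)
    assume "\<not> \<bar>t\<bar> \<le> r"
    then have t': "t \<in> - {-r..r}" by auto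
    have "((\<lambda>_. 0) has_real_derivative 0) (at t)" by simp
    then have "(f has_real_derivative 0) (at t)"
    proof (rule has_field_derivative_transform_within_open[of _ _ _ "- {-r..r}"])
      show "open (- {-r..r})" by (auto simp: closed_atLeastAtMost)
      show "t \<in> - {-r..r}" by (fact t')
      show "0 = f x" if "x \<in> - {-r..r}" for x using that f(2)[rule_format, of x] by force
    qed
    then show False using t DERIV_imp_deriv by blast
  qed
qed (auto intro: smooth_fun_deriv)

lemma bump_on_bounded:
  assumes "bump_on r f"
  obtains B where "B \<ge> 0" "\<And>t. \<bar>f t\<bar> \<le> B * indicator {-r..r} t"
proof -
  have "compact (f ` {-r..r})"
    using assms by (intro compact_continuous_image smooth_fun_continuous) (auto simp: bump_on_def)
  then obtain B where B: "\<And>t. t \<in> {-r..r} \<Longrightarrow> \<bar>f t\<bar> \<le> B"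
    using compact_imp_bounded[of "f ` {-r..r}"] by (simp add: bounded_iff) (meson atLeastAtMost_iff)
  show ?thesis
  proof (rule that[of "max B 0"])
    show "\<bar>f t\<bar> \<le> max B 0 * indicator {-r..r} t" for t
    proof (cases "t \<in> {-r..r}")
      case True
      then show ?thesis using B[of t] by (simp add: le_max_iff_disj)
    next
      case False
      then have "f t = 0" using assms by (force simp: bump_on_def)
      then show ?thesis by simp
    qed
  qed auto
qed

text \<open>
The index \<open>k\<close> sharpens the flanks: since \<open>exp (-1/(k s)) \<longrightarrow> 1\<close> for \<open>s > 0\<close>, these functions converge to
the indicator of \<open>(a, b)\<close> from below without ever leaving its support.
\<close>

definition bump :: "nat \<Rightarrow> real \<Rightarrow> real \<Rightarrow> real \<Rightarrow> real" where
  "bump k a b t = flat 1 (real (Suc k) * (t - a)) * flat 1 (real (Suc k) * (b - t))"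

lemma flat_1_bounds: "0 \<le> flat 1 t" "flat 1 t \<le> 1"
  by (auto simp: flat_def)

lemma bump_bounds: "0 \<le> bump k a b t" "bump k a b t \<le> indicator {a<..<b} t"
proof -
  show "0 \<le> bump k a b t" by (simp add: bump_def flat_1_bounds)
  show "bump k a b t \<le> indicator {a<..<b} t"
  proof (cases "t \<in> {a<..<b}")
    case True
    then show ?thesis using mult_mono[OF flat_1_bounds(2) flat_1_bounds(2)] by (simp add: bump_def flat_1_bounds)
  next
    case False
    then have "real (Suc k) * (t - a) \<le> 0 \<or> real (Suc k) * (b - t) \<le> 0"
      by (auto simp: mult_le_0_iff not_less)
    then show ?thesis by (auto simp: bump_def flat_def)
  qed
qed

lemma smooth_fun_bump: "smooth_fun (bump k a b)"
proof -
  have "smooth_fun (\<lambda>t. flat 1 (real (Suc k) * t + real (Suc k) * (- a)) * flat 1 ((- real (Suc k)) * t + real (Suc k) * b))"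
    by (intro smooth_fun.intros)
  also have "(\<lambda>t. flat 1 (real (Suc k) * t + real (Suc k) * (- a)) * flat 1 ((- real (Suc k)) * t + real (Suc k) * b)) = bump k a b"
    by (rule ext) (simp add: bump_def algebra_simps)
  finally show ?thesis .
qed

lemma bump_on_bump: "bump_on (max \<bar>a\<bar> \<bar>b\<bar>) (bump k a b)"
  unfolding bump_on_def
proof safe
  fix t assume "bump k a b t \<noteq> 0"
  then have "t \<in> {a<..<b}"
    using bump_bounds[of k a b t] by (cases "t \<in> {a<..<b}") (auto simp del: greaterThanLessThan_iff)
  then show "\<bar>t\<bar> \<le> max \<bar>a\<bar> \<bar>b\<bar>" by auto
qed (rule smooth_fun_bump)

lemma bump_tendsto_indicator: "(\<lambda>k. bump k a b t) \<longlonglongrightarrow> indicator {a<..<b} t"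
proof (cases "t \<in> {a<..<b}")
  case True
  have lim: "(\<lambda>k. flat 1 (real (Suc k) * s)) \<longlonglongrightarrow> 1" if "s > 0" for s
  proof -
    have "(\<lambda>k. exp (- (inverse s * inverse (real (Suc k))))) \<longlonglongrightarrow> exp (- (inverse s * 0))"
      by (intro tendsto_intros LIMSEQ_inverse_real_of_nat)
    then show ?thesis using that by (simp add: flat_def mult.commute)
  qed
  show ?thesis
    using tendsto_mult[OF lim[of "t - a"] lim[of "b - t"]] True by (simp add: bump_def)
next
  case False
  then have "bump k a b t = 0" for k
    using bump_bounds[of k a b t] by simp
  then show ?thesis using False by simp
qed

section \<open>Products of bump functions as test functions\<close>

definition tensor :: "nat \<Rightarrow> (nat \<Rightarrow> real \<Rightarrow> real) \<Rightarrow> (nat \<Rightarrow> real) \<Rightarrow> real" where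
  "tensor n \<psi> x = (\<Prod>j\<in>{1..n}. \<psi> j (x j))"

lemma tensor_upd:
  assumes "k \<in> {1..n}"
  shows "tensor n (\<psi>(k := f)) (x(k := t)) = f t * (\<Prod>j\<in>{1..n} - {k}. \<psi> j (x j))"
proof -
  have "tensor n (\<psi>(k := f)) (x(k := t))
      = f t * (\<Prod>j\<in>{1..n} - {k}. (\<psi>(k := f)) j ((x(k := t)) j))"
    unfolding tensor_def by (subst prod.remove[OF _ assms]) simp_all
  also have "(\<Prod>j\<in>{1..n} - {k}. (\<psi>(k := f)) j ((x(k := t)) j)) = (\<Prod>j\<in>{1..n} - {k}. \<psi> j (x j))"
    by (intro prod.cong) auto
  finally show ?thesis .
qed

lemma tensor_upd_point:
  assumes "k \<in> {1..n}"
  shows "tensor n \<psi> (x(k := t)) = \<psi> k t * (\<Prod>j\<in>{1..n} - {k}. \<psi> j (x j))"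
  using tensor_upd[OF assms, of \<psi> "\<psi> k"] by simp

lemma tensor_upd_fun:
  assumes "k \<in> {1..n}"
  shows "tensor n (\<psi>(k := f)) x = f (x k) * (\<Prod>j\<in>{1..n} - {k}. \<psi> j (x j))"
  using tensor_upd[OF assms, of \<psi> f x "x k"] by simp

lemma pd_tensor:
  assumes "k \<in> {1..n}" "smooth_fun (\<psi> k)"
  shows "pd k (tensor n \<psi>) = tensor n (\<psi>(k := deriv (\<psi> k)))"
proof
  fix x
  have "((\<lambda>t. tensor n \<psi> (x(k := t))) has_real_derivative
      deriv (\<psi> k) (x k) * (\<Prod>j\<in>{1..n} - {k}. \<psi> j (x j))) (at (x k))"
    unfolding tensor_upd_point[OF assms(1)]
    by (intro DERIV_cmult_right smooth_fun_deriv assms)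
  then show "pd k (tensor n \<psi>) x = tensor n (\<psi>(k := deriv (\<psi> k))) x"
    using tensor_upd_fun[OF assms(1), of \<psi> "deriv (\<psi> k)" x] by (simp add: pd_def DERIV_imp_deriv)
qed

text \<open>
Differentiation acts on a single factor, so iterated partial derivatives of a product are again products; this
is what reduces smoothness in several variables to the line.
\<close>

lemma iter_pd_tensor:
  assumes "ks \<in> lists {1..n}" "\<And>j. smooth_fun (\<psi> j)"
  shows "\<exists>\<psi>'. (\<forall>j. smooth_fun (\<psi>' j)) \<and> iter_pd ks (tensor n \<psi>) = tensor n \<psi>'"
  using assms(1)
proof (induction ks)
  case Nil
  then show ?case using assms(2) by auto
next
  case (Cons k ks)
  then obtain \<psi>' where \<psi>': "\<And>j. smooth_fun (\<psi>' j)" "iter_pd ks (tensor n \<psi>) = tensor n \<psi>'" by auto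
  then have "iter_pd (k # ks) (tensor n \<psi>) = tensor n (\<psi>'(k := deriv (\<psi>' k)))"
    using Cons.hyps by (simp add: pd_tensor)
  moreover have "\<forall>j. smooth_fun ((\<psi>'(k := deriv (\<psi>' k))) j)"
    using \<psi>' by (auto intro: smooth_fun_deriv)
  ultimately show ?case by blast
qed

lemma continuous_map_tensor:
  assumes "\<And>j. smooth_fun (\<psi> j)"
  shows "continuous_map (powertop_real {1..n}) euclideanreal (tensor n \<psi>)"
proof -
  have "continuous_map (powertop_real {1..n}) euclideanreal (\<psi> j \<circ> (\<lambda>x. x j))" if "j \<in> {1..n}" for j
    using that assms[of j]
    by (intro continuous_map_compose[of _ euclideanreal] continuous_map_product_projection)
       (simp_all add: smooth_fun_continuous)
  then show ?thesis
    unfolding tensor_def[abs_def] by (intro continuous_map_prod) (simp_all add: o_def)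
qed

lemma tensor_zero_outside_cube:
  assumes "\<And>j. bump_on r (\<psi> j)" "x \<in> Rn n - cube n r"
  shows "tensor n \<psi> x = 0"
proof -
  from assms(2) obtain j where j: "j \<in> {1..n}" "x j \<notin> {-r..r}"
    by (auto simp: Rn_def cube_def PiE_iff)
  then have "\<psi> j (x j) = 0" using assms(1)[of j] by (force simp: bump_on_def)
  then show ?thesis using j(1) by (force simp: tensor_def)
qed

lemma test_function_tensor:
  assumes "\<And>j. bump_on r (\<psi> j)"
  shows "test_function n (tensor n \<psi>)"
  unfolding test_function_def
proof
  have smooth: "smooth_fun (\<psi> j)" for j using assms by (simp add: bump_on_def)
  show "smooth_Rn n (tensor n \<psi>)"
    unfolding smooth_Rn_def
  proof (intro ballI conjI)
    fix ks assume "ks \<in> lists {1..n}"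
    then obtain \<psi>' where \<psi>': "\<And>j. smooth_fun (\<psi>' j)" "iter_pd ks (tensor n \<psi>) = tensor n \<psi>'"
      using iter_pd_tensor[of ks n \<psi>] smooth by blast
    show "continuous_map (powertop_real {1..n}) euclideanreal (iter_pd ks (tensor n \<psi>))"
      unfolding \<psi>'(2) by (rule continuous_map_tensor) (rule \<psi>')
    fix k x assume "k \<in> {1..n}" "x \<in> Rn n"
    then show "(\<lambda>t. iter_pd ks (tensor n \<psi>) (x(k := t))) differentiable at (x k)"
      unfolding \<psi>'(2) tensor_upd_point[OF \<open>k \<in> {1..n}\<close>]
      by (intro differentiable_mult differentiable_const)
         (use \<psi>'(1) smooth_fun_deriv(2) real_differentiable_def in blast)
  qed
  show "\<exists>r. \<forall>x\<in>Rn n - cube n r. tensor n \<psi> x = 0"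
  proof (intro exI ballI)
    fix x assume x: "x \<in> Rn n - cube n r"
    show "tensor n \<psi> x = 0" by (rule tensor_zero_outside_cube[OF assms x])
  qed
qed

lemma space_lebesgue_Rn [simp]: "space (lebesgue_Rn n) = Rn n"
  by (simp add: lebesgue_Rn_def Rn_def space_PiM)

lemma cube_measurable [measurable]: "cube n r \<in> sets (lebesgue_Rn n)"
  unfolding cube_def lebesgue_Rn_def by (rule sets_PiM_I_finite) auto

lemma cube_mono: "r \<le> s \<Longrightarrow> cube n r \<subseteq> cube n s"
  unfolding cube_def by (intro PiE_mono) auto

lemma in_cube_eventually:
  assumes "x \<in> Rn n"
  shows "\<forall>\<^sub>F k in sequentially. x \<in> cube n (real k)"
proof -
  have "\<forall>\<^sub>F k in sequentially. \<forall>j\<in>{1..n}. x j \<in> {-real k..real k}"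
  proof (rule eventually_ball_finite)
    show "\<forall>j\<in>{1..n}. \<forall>\<^sub>F k in sequentially. x j \<in> {-real k..real k}"
    proof
      fix j
      show "\<forall>\<^sub>F k in sequentially. x j \<in> {-real k..real k}"
        using eventually_ge_at_top[of "nat \<lceil>\<bar>x j\<bar>\<rceil>"]
      proof eventually_elim
        fix k assume "nat \<lceil>\<bar>x j\<bar>\<rceil> \<le> k"
        then have "real (nat \<lceil>\<bar>x j\<bar>\<rceil>) \<le> real k" by (rule of_nat_mono)
        then have "\<bar>x j\<bar> \<le> real k" using real_nat_ceiling_ge[of "\<bar>x j\<bar>"] by linarith
        then show "x j \<in> {-real k..real k}" by auto
      qed
    qed
  qed simp
  then show ?thesis
    by eventually_elim (use assms in \<open>auto simp: cube_def Rn_def PiE_iff\<close>)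
qed

lemma locally_integrable_measurable:
  assumes "locally_integrable n w"
  shows "w \<in> borel_measurable (lebesgue_Rn n)"
proof (rule borel_measurable_LIMSEQ_real)
  show "(\<lambda>x. indicator (cube n (real k)) x * w x) \<in> borel_measurable (lebesgue_Rn n)" for k
    using assms by (auto simp: locally_integrable_def set_integrable_def)
  fix x assume "x \<in> space (lebesgue_Rn n)"
  then have "\<forall>\<^sub>F k in sequentially. x \<in> cube n (real k)" by (intro in_cube_eventually) simp
  then show "(\<lambda>k. indicator (cube n (real k)) x * w x) \<longlonglongrightarrow> w x"
    by (intro tendsto_eventually) (erule eventually_mono, simp)
qed

lemma measurable_restrict_Rn:
  "i \<le> n \<Longrightarrow> (\<lambda>x. restrict x {1..i}) \<in> measurable (lebesgue_Rn n) (lebesgue_Rn i)"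
  unfolding lebesgue_Rn_def by (rule measurable_restrict_subset) auto

lemma measurable_component_Rn:
  "i \<in> {1..n} \<Longrightarrow> (\<lambda>x. x i) \<in> borel_measurable (lebesgue_Rn n)"
  unfolding lebesgue_Rn_def using measurable_component_singleton[of i "{1..n}" "\<lambda>_. lborel"] by simp

text \<open>
Continuity is meant on the extensional function space, which is not the type-wide product space whose Borel
sets are generated by the coordinates. Extending points by zero moves the function there.
\<close>

lemma continuous_map_lebesgue_Rn_measurable:
  assumes "continuous_map (powertop_real {1..n}) euclideanreal \<phi>"
  shows "\<phi> \<in> borel_measurable (lebesgue_Rn n)"
proof -
  define ext :: "(nat \<Rightarrow> real) \<Rightarrow> nat \<Rightarrow> real" where "ext x i = (if i \<in> {1..n} then x i else 0)" for x i
  have "(\<lambda>x. ext x i) \<in> borel_measurable (lebesgue_Rn n)" for i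
    by (cases "i \<in> {1..n}") (simp_all add: ext_def measurable_component_Rn del: atLeastAtMost_iff One_nat_def)
  then have ext: "ext \<in> borel_measurable (lebesgue_Rn n)"
    by (rule measurable_coordinatewise_then_product)
  have "continuous_map (product_topology (\<lambda>_. euclideanreal) UNIV) (powertop_real {1..n}) (\<lambda>z :: nat \<Rightarrow> real. restrict z {1..n})"
    unfolding continuous_map_componentwise
    by (auto intro: continuous_map_product_projection simp del: atLeastAtMost_iff)
  from continuous_map_compose[OF this assms]
  have "continuous_on UNIV (\<lambda>z. \<phi> (restrict z {1..n}))"
    by (simp add: euclidean_product_topology o_def)
  then have "(\<lambda>z. \<phi> (restrict z {1..n})) \<in> borel_measurable borel"
    by (rule borel_measurable_continuous_onI)
  from measurable_compose[OF ext this]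
  show ?thesis
  proof (rule measurable_cong[THEN iffD1, rotated])
    fix x assume "x \<in> space (lebesgue_Rn n)"
    then have "restrict (ext x) {1..n} = x"
      by (auto simp: Rn_def PiE_iff extensional_def ext_def restrict_def fun_eq_iff)
    then show "\<phi> (restrict (ext x) {1..n}) = \<phi> x" by simp
  qed
qed

lemma compactly_supported_bounded:
  assumes "continuous_map (powertop_real {1..n}) euclideanreal \<phi>"
    and "\<And>x. x \<in> Rn n - cube n r \<Longrightarrow> \<phi> x = 0"
  obtains B where "B \<ge> 0" "\<And>x. x \<in> Rn n \<Longrightarrow> \<bar>\<phi> x\<bar> \<le> B * indicator (cube n r) x"
proof -
  have "compactin (powertop_real {1..n}) (cube n r)"
    unfolding cube_def by (simp add: compactin_PiE)
  from image_compactin[OF this assms(1)] have "compact (\<phi> ` cube n r)" by simp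
  then obtain B where B: "\<And>x. x \<in> cube n r \<Longrightarrow> \<bar>\<phi> x\<bar> \<le> B"
    using compact_imp_bounded[of "\<phi> ` cube n r"] by (auto simp: bounded_iff)
  show ?thesis
  proof (rule that[of "max B 0"])
    fix x assume "x \<in> Rn n"
    then show "\<bar>\<phi> x\<bar> \<le> max B 0 * indicator (cube n r) x"
      using B[of x] assms(2)[of x] by (cases "x \<in> cube n r") auto
  qed simp
qed

lemma integrable_mult_compactly_supported:
  assumes w: "locally_integrable n w"
    and cont: "continuous_map (powertop_real {1..n}) euclideanreal \<phi>"
    and supp: "\<And>x. x \<in> Rn n - cube n r \<Longrightarrow> \<phi> x = 0"
  shows "integrable (lebesgue_Rn n) (\<lambda>x. w x * \<phi> x)"
proof -
  obtain B where B: "B \<ge> 0" "\<And>x. x \<in> Rn n \<Longrightarrow> \<bar>\<phi> x\<bar> \<le> B * indicator (cube n r) x"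
    using compactly_supported_bounded[OF cont supp] by blast
  have [measurable]: "w \<in> borel_measurable (lebesgue_Rn n)" by (rule locally_integrable_measurable[OF w])
  have [measurable]: "\<phi> \<in> borel_measurable (lebesgue_Rn n)"
    by (rule continuous_map_lebesgue_Rn_measurable[OF cont])
  show ?thesis
  proof (rule Bochner_Integration.integrable_bound)
    show "integrable (lebesgue_Rn n) (\<lambda>x. B * (indicator (cube n r) x * w x))"
      using w by (intro integrable_mult_right) (simp add: locally_integrable_def set_integrable_def)
    show "AE x in lebesgue_Rn n. norm (w x * \<phi> x) \<le> norm (B * (indicator (cube n r) x * w x))"
    proof (rule AE_I2)
      fix x assume "x \<in> space (lebesgue_Rn n)"
      then show "norm (w x * \<phi> x) \<le> norm (B * (indicator (cube n r) x * w x))"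
        using mult_left_mono[OF B(2)[of x], of "\<bar>w x\<bar>"] B(1) by (simp add: abs_mult mult_ac)
    qed
  qed measurable
qed

lemma integrable_mult_tensor:
  assumes "locally_integrable n w" and \<psi>: "\<And>j. bump_on r (\<psi> j)"
  shows "integrable (lebesgue_Rn n) (\<lambda>x. w x * tensor n \<psi> x)"
  using assms(1)
proof (rule integrable_mult_compactly_supported)
  show "continuous_map (powertop_real {1..n}) euclideanreal (tensor n \<psi>)"
    using \<psi> by (intro continuous_map_tensor) (simp add: bump_on_def)
  show "tensor n \<psi> x = 0" if "x \<in> Rn n - cube n r" for x
    by (rule tensor_zero_outside_cube[OF \<psi> that])
qed

section \<open>Functions orthogonal to all bump functions\<close>

text \<open>
The positive and the negative part of \<open>w\<close> define two measures that agree on an intersection-stable generator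
where they are finite. They are therefore equal, and so are their densities.
\<close>

lemma AE_zero_if_zero_on_generator:
  fixes w :: "'a \<Rightarrow> real"
  assumes "sigma_finite_measure M" and w [measurable]: "w \<in> borel_measurable M"
    and E: "Int_stable E" "E \<subseteq> Pow (space M)" "sets M = sigma_sets (space M) E"
    and A: "range (A :: nat \<Rightarrow> 'a set) \<subseteq> E" "(\<Union>i. A i) = space M"
    and int: "\<And>X. X \<in> E \<Longrightarrow> integrable M (\<lambda>x. indicator X x * w x)"
    and zero: "\<And>X. X \<in> E \<Longrightarrow> (\<integral>x. indicator X x * w x \<partial>M) = 0"
  shows "AE x in M. w x = 0"
proof -
  interpret sigma_finite_measure M by fact
  have meas: "X \<in> sets M" if "X \<in> E" for X using that by (simp add: E(3))
  have em: "emeasure (density M (\<lambda>x. ennreal (s * w x))) X = (\<integral>\<^sup>+x. ennreal (s * (indicator X x * w x)) \<partial>M)"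
    if "X \<in> E" for X and s :: real
    using meas[OF that] by (subst emeasure_density) (auto intro!: nn_integral_cong simp: indicator_def)
  have fin: "(\<integral>\<^sup>+x. ennreal (s * (indicator X x * w x)) \<partial>M) < \<infinity>" if "X \<in> E" for X and s :: real
  proof -
    have "integrable M (\<lambda>x. s * (indicator X x * w x))" using int[OF that] by simp
    then have "(\<integral>\<^sup>+x. ennreal (norm (s * (indicator X x * w x))) \<partial>M) < \<infinity>"
      unfolding integrable_iff_bounded by (rule conjunct2)
    then show ?thesis
      by (rule le_less_trans[rotated]) (auto intro!: nn_integral_mono ennreal_leI)
  qed
  have "density M (\<lambda>x. ennreal (1 * w x)) = density M (\<lambda>x. ennreal (- 1 * w x))"
  proof (rule measure_eqI_generator_eq[OF E(1,2) _ _ _ A])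
    fix X assume X: "X \<in> E"
    have "0 = enn2real (\<integral>\<^sup>+x. ennreal (1 * (indicator X x * w x)) \<partial>M)
        - enn2real (\<integral>\<^sup>+x. ennreal (- 1 * (indicator X x * w x)) \<partial>M)"
      using zero[OF X] real_lebesgue_integral_def[OF int[OF X]] by simp
    then show "emeasure (density M (\<lambda>x. ennreal (1 * w x))) X = emeasure (density M (\<lambda>x. ennreal (- 1 * w x))) X"
      unfolding em[OF X] using fin[OF X, of 1] fin[OF X, of "-1"]
      by (metis diff_eq_diff_eq diff_self ennreal_enn2real infinity_ennreal_def)
  next
    show "emeasure (density M (\<lambda>x. ennreal (1 * w x))) (A i) \<noteq> \<infinity>" for i
    proof -
      have "A i \<in> E" using A by auto
      then show ?thesis using em[of "A i" 1] fin[of "A i" 1] by simp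
    qed
  qed (simp_all add: E)
  then have "AE x in M. ennreal (1 * w x) = ennreal (- 1 * w x)"
    by (intro density_unique) auto
  then show ?thesis
  proof eventually_elim
    fix x assume "ennreal (1 * w x) = ennreal (- 1 * w x)"
    then show "w x = 0"
      by (cases "w x" "0 :: real" rule: linorder_cases) (simp_all add: ennreal_neg)
  qed
qed

text \<open>
Rational endpoints keep the generator countable, which matters on the line, where the exceptional null sets of
all its members have to be united.
\<close>

definition rat_intervals :: "real set set" where
  "rat_intervals = (\<lambda>(a, b). {a<..<b}) ` (\<rat> \<times> \<rat>)"

lemma rat_intervalsE:
  assumes "X \<in> rat_intervals" obtains a b where "a \<in> \<rat>" "b \<in> \<rat>" "X = {a<..<b}"
  using assms by (auto simp: rat_intervals_def)

lemma Int_stable_rat_intervals: "Int_stable rat_intervals"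
proof (rule Int_stableI)
  fix X Y assume "X \<in> rat_intervals" "Y \<in> rat_intervals"
  then obtain a b c d where *: "a \<in> \<rat>" "b \<in> \<rat>" "c \<in> \<rat>" "d \<in> \<rat>" "X = {a<..<b}" "Y = {c<..<d}"
    by (metis rat_intervalsE)
  have "X \<inter> Y = {max a c<..<min b d}" "max a c \<in> \<rat>" "min b d \<in> \<rat>"
    using * by (auto simp: max_def min_def)
  then show "X \<inter> Y \<in> rat_intervals" by (auto simp: rat_intervals_def)
qed

lemma symmetric_interval_rat: "{- real k<..<real k} \<in> rat_intervals"
  by (auto simp: rat_intervals_def intro!: image_eqI[of _ _ "(- real k, real k)"])

lemma UN_symmetric_interval: "(\<Union>k. {- real k<..<real k}) = UNIV"
proof -
  have "\<exists>k. \<bar>x\<bar> < real k" for x by (rule reals_Archimedean2)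
  then show ?thesis by (auto simp: abs_less_iff) (metis minus_less_iff)
qed

lemma borel_eq_sigma_rat_intervals: "(borel :: real measure) = sigma UNIV rat_intervals"
proof (rule borel_eq_countable_basis)
  show "countable rat_intervals" by (simp add: rat_intervals_def countable_rat)
  show "topological_basis rat_intervals"
  proof (rule topological_basisI)
    show "open X" if "X \<in> rat_intervals" for X using that by (auto elim!: rat_intervalsE)
    fix U :: "real set" and x assume "open U" "x \<in> U"
    then obtain e where e: "e > 0" "ball x e \<subseteq> U" by (meson openE)
    obtain a b where ab: "a \<in> \<rat>" "x - e < a" "a < x" "b \<in> \<rat>" "x < b" "b < x + e"
      using Rats_dense_in_real[of "x - e" x] Rats_dense_in_real[of x "x + e"] e(1) by auto
    have "{a<..<b} \<in> rat_intervals" using ab by (auto simp: rat_intervals_def)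
    moreover have "x \<in> {a<..<b}" using ab by simp
    moreover have "{a<..<b} \<subseteq> U"
      using ab e(2) by (intro order_trans[OF _ e(2)]) (auto simp: dist_real_def abs_if)
    ultimately show "\<exists>B'\<in>rat_intervals. x \<in> B' \<and> B' \<subseteq> U" by blast
  qed
qed

definition rat_boxes :: "nat \<Rightarrow> (nat \<Rightarrow> real) set set" where
  "rat_boxes n = {PiE {1..n} X | X. \<forall>i\<in>{1..n}. X i \<in> rat_intervals}"

lemma Int_stable_rat_boxes: "Int_stable (rat_boxes n)"
proof (rule Int_stableI)
  fix P Q assume "P \<in> rat_boxes n" "Q \<in> rat_boxes n"
  then obtain X Y where "P = PiE {1..n} X" "Q = PiE {1..n} Y"
    "\<forall>i\<in>{1..n}. X i \<in> rat_intervals" "\<forall>i\<in>{1..n}. Y i \<in> rat_intervals" by (auto simp: rat_boxes_def)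
  then show "P \<inter> Q \<in> rat_boxes n"
    using Int_stable_rat_intervals unfolding rat_boxes_def Int_stable_def
    by (auto simp: PiE_Int intro!: exI[of _ "\<lambda>i. X i \<inter> Y i"])
qed

lemma sets_lebesgue_Rn_rat_boxes: "sets (lebesgue_Rn n) = sigma_sets (Rn n) (rat_boxes n)"
proof -
  have "sets (lebesgue_Rn n) = sets (\<Pi>\<^sub>M i\<in>{1..n}. sigma UNIV rat_intervals)"
    unfolding lebesgue_Rn_def by (intro sets_PiM_cong) (simp_all add: borel_eq_sigma_rat_intervals[symmetric])
  also have "\<dots> = sets (sigma (Rn n) {{f\<in>(\<Pi>\<^sub>E i\<in>{1..n}. UNIV). \<forall>i\<in>j. f i \<in> A i} | A j. j \<in> {{1..n}} \<and> A \<in> Pi j (\<lambda>_. rat_intervals)})"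
    unfolding Rn_def
  proof (rule sets_PiM_sigma)
    show "\<exists>S\<subseteq>rat_intervals. countable S \<and> UNIV = \<Union> S"
      by (intro exI[of _ "range (\<lambda>k. {- real k<..<real k})"])
         (use symmetric_interval_rat UN_symmetric_interval in auto)
  qed auto
  also have "{{f\<in>(\<Pi>\<^sub>E i\<in>{1..n}. UNIV). \<forall>i\<in>j. f i \<in> A i} | A j. j \<in> {{1..n}} \<and> A \<in> Pi j (\<lambda>_. rat_intervals)} = rat_boxes n"
    unfolding rat_boxes_def by (intro Collect_cong iff_exI) (auto simp: PiE_iff Pi_iff extensional_def)
  also have "sets (sigma (Rn n) (rat_boxes n)) = sigma_sets (Rn n) (rat_boxes n)"
    by (rule sets_measure_of) (auto simp: rat_boxes_def Rn_def PiE_iff)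
  finally show ?thesis .
qed

interpretation lborel_family: product_sigma_finite "\<lambda>_::nat. lborel :: real measure"
  by standard

lemma sigma_finite_lebesgue_Rn: "sigma_finite_measure (lebesgue_Rn n)"
  unfolding lebesgue_Rn_def by (rule lborel_family.sigma_finite) simp

text \<open>
The fundamental lemma of the calculus of variations. Products of bumps converge boundedly to the indicators of
boxes, so \<open>w\<close> integrates to zero over every box, and boxes generate the measurable sets.
\<close>

lemma AE_zero_if_orthogonal_to_bumps:
  assumes w: "locally_integrable n w"
    and orth: "\<And>\<psi> r. (\<And>j. bump_on r (\<psi> j)) \<Longrightarrow> (\<integral>x. w x * tensor n \<psi> x \<partial>lebesgue_Rn n) = 0"
  shows "AE x in lebesgue_Rn n. w x = 0"
proof (rule AE_zero_if_zero_on_generator[OF sigma_finite_lebesgue_Rn _ Int_stable_rat_boxes])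
  have [measurable]: "w \<in> borel_measurable (lebesgue_Rn n)" by (rule locally_integrable_measurable[OF w])
  show "w \<in> borel_measurable (lebesgue_Rn n)" by measurable
  show "rat_boxes n \<subseteq> Pow (space (lebesgue_Rn n))" by (auto simp: rat_boxes_def Rn_def PiE_iff)
  show "sets (lebesgue_Rn n) = sigma_sets (space (lebesgue_Rn n)) (rat_boxes n)"
    by (simp add: sets_lebesgue_Rn_rat_boxes)
  let ?A = "\<lambda>k. PiE {1..n} (\<lambda>_. {- real k<..<real k})"
  show "range ?A \<subseteq> rat_boxes n" using symmetric_interval_rat by (auto simp: rat_boxes_def)
  show "(\<Union>k. ?A k) = space (lebesgue_Rn n)"
  proof (intro equalityI subsetI)
    fix x assume "x \<in> space (lebesgue_Rn n)"
    then have x: "x \<in> Rn n" by simp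
    obtain k where "x \<in> cube n (real k)"
      using in_cube_eventually[OF x] by (meson eventually_happens sequentially_bot)
    then have "x \<in> ?A (Suc k)" by (force simp: cube_def PiE_iff)
    then show "x \<in> (\<Union>k. ?A k)" by blast
  qed (auto simp: Rn_def PiE_iff)
  fix P assume "P \<in> rat_boxes n"
  then obtain X where X: "P = PiE {1..n} X" "\<And>i. i \<in> {1..n} \<Longrightarrow> X i \<in> rat_intervals"
    unfolding rat_boxes_def by auto
  have "\<exists>a b. i \<in> {1..n} \<longrightarrow> X i = {a<..<b}" for i
  proof (cases "i \<in> {1..n}")
    case True
    from X(2)[OF True] obtain a b where "X i = {a<..<b}" by (rule rat_intervalsE)
    then show ?thesis by blast
  qed blast
  then obtain a b where ab: "\<And>i. i \<in> {1..n} \<Longrightarrow> X i = {a i<..<b i}" by metis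
  \<comment> \<open>Values outside the index set are fixed so that a single radius bounds all factors.\<close>
  define a' where "a' i = (if i \<in> {1..n} then a i else 0)" for i
  define b' where "b' i = (if i \<in> {1..n} then b i else 0)" for i
  have P: "P = PiE {1..n} (\<lambda>i. {a' i<..<b' i})"
    unfolding X(1) by (intro PiE_cong) (simp add: ab a'_def b'_def)
  define r where "r = Max ((\<lambda>i. max \<bar>a' i\<bar> \<bar>b' i\<bar>) ` {0..n})"
  define \<psi> where "\<psi> k i = bump k (a' i) (b' i)" for k i
  have le_r: "max \<bar>a' i\<bar> \<bar>b' i\<bar> \<le> r" for i
  proof (cases "i \<in> {0..n}")
    case False
    have "max \<bar>a' i\<bar> \<bar>b' i\<bar> = max \<bar>a' 0\<bar> \<bar>b' 0\<bar>" using False by (simp add: a'_def b'_def)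
    also have "\<dots> \<le> r" unfolding r_def by (intro Max_ge) auto
    finally show ?thesis .
  next
    case True
    then show ?thesis unfolding r_def by (intro Max_ge) (simp, blast)
  qed
  have \<psi>: "bump_on r (\<psi> k i)" for k i
    unfolding \<psi>_def by (rule bump_on_mono[OF bump_on_bump le_r])
  have P_cube: "P \<subseteq> cube n r"
    unfolding P cube_def
  proof (rule PiE_mono)
    fix i show "{a' i<..<b' i} \<subseteq> {- r..r}" using le_r[of i] by auto
  qed
  have [measurable]: "P \<in> sets (lebesgue_Rn n)"
    unfolding P lebesgue_Rn_def by (rule sets_PiM_I_finite) auto
  have dom: "integrable (lebesgue_Rn n) (\<lambda>x. \<bar>indicator (cube n r) x * w x\<bar>)"
    using w by (intro integrable_abs) (simp add: locally_integrable_def set_integrable_def)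
  have lim: "AE x in lebesgue_Rn n. (\<lambda>k. w x * tensor n (\<psi> k) x) \<longlonglongrightarrow> indicator P x * w x"
  proof (rule AE_I2)
    fix x assume x: "x \<in> space (lebesgue_Rn n)"
    have "(\<lambda>k. tensor n (\<psi> k) x) \<longlonglongrightarrow> (\<Prod>j\<in>{1..n}. indicator {a' j<..<b' j} (x j))"
      unfolding tensor_def \<psi>_def by (intro tendsto_prod bump_tendsto_indicator)
    also have "(\<Prod>j\<in>{1..n}. indicator {a' j<..<b' j} (x j)) = (indicator P x :: real)"
      using x unfolding P by (auto simp: indicator_def Rn_def PiE_iff)
    finally show "(\<lambda>k. w x * tensor n (\<psi> k) x) \<longlonglongrightarrow> indicator P x * w x"
      by (subst mult.commute) (rule tendsto_mult_left)
  qed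
  have bound: "AE x in lebesgue_Rn n. norm (w x * tensor n (\<psi> k) x) \<le> \<bar>indicator (cube n r) x * w x\<bar>" for k
  proof (rule AE_I2)
    fix x assume x: "x \<in> space (lebesgue_Rn n)"
    have "\<bar>tensor n (\<psi> k) x\<bar> \<le> (\<Prod>j\<in>{1..n}. indicator {a' j<..<b' j} (x j))"
      unfolding tensor_def abs_prod \<psi>_def using bump_bounds by (intro prod_mono) auto
    also have "(\<Prod>j\<in>{1..n}. indicator {a' j<..<b' j} (x j)) = (indicator P x :: real)"
      using x unfolding P by (auto simp: indicator_def Rn_def PiE_iff)
    also have "\<dots> \<le> indicator (cube n r) x"
      using P_cube by (auto simp: indicator_def)
    finally show "norm (w x * tensor n (\<psi> k) x) \<le> \<bar>indicator (cube n r) x * w x\<bar>"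
      by (simp add: abs_mult mult.commute mult_left_mono)
  qed
  have meas: "(\<lambda>x. w x * tensor n (\<psi> k) x) \<in> borel_measurable (lebesgue_Rn n)" for k
    by (rule borel_measurable_integrable[OF integrable_mult_tensor[OF w \<psi>]])
  show "integrable (lebesgue_Rn n) (\<lambda>x. indicator P x * w x)"
    by (rule integrable_dominated_convergence[OF _ meas dom lim bound]) measurable
  have "(\<lambda>k. \<integral>x. w x * tensor n (\<psi> k) x \<partial>lebesgue_Rn n) \<longlonglongrightarrow> (\<integral>x. indicator P x * w x \<partial>lebesgue_Rn n)"
    by (rule integral_dominated_convergence[OF _ meas dom lim bound]) measurable
  then show "(\<integral>x. indicator P x * w x \<partial>lebesgue_Rn n) = 0"
    using orth[OF \<psi>] by (simp add: LIMSEQ_const_iff)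
qed

section \<open>Weak derivatives and substitution on the line\<close>

definition locally_integrable_real :: "(real \<Rightarrow> real) \<Rightarrow> bool" where
  "locally_integrable_real f \<longleftrightarrow> (\<forall>r. set_integrable lborel {-r..r} f)"

lemma locally_integrable_real_measurable:
  assumes "locally_integrable_real f"
  shows "f \<in> borel_measurable borel"
proof (rule borel_measurable_LIMSEQ_real)
  have "integrable lborel (\<lambda>x. indicator {-real k..real k} x * f x)" for k
    using assms by (simp add: locally_integrable_real_def set_integrable_def)
  from borel_measurable_integrable[OF this]
  show "(\<lambda>x. indicator {-real k..real k} x * f x) \<in> borel_measurable borel" for k
    by simp
  fix x :: real
  obtain k0 :: nat where "\<bar>x\<bar> \<le> real k0" using real_arch_simple by blast
  then have "\<forall>\<^sub>F k in sequentially. indicator {-real k..real k} x * f x = f x"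
    by (intro eventually_mono[OF eventually_ge_at_top[of k0]]) (auto simp: indicator_def)
  then show "(\<lambda>k. indicator {-real k..real k} x * f x) \<longlonglongrightarrow> f x"
    by (rule tendsto_eventually)
qed

lemma locally_integrable_real_continuous:
  assumes "continuous_on UNIV f"
  shows "locally_integrable_real f"
  unfolding locally_integrable_real_def
  by (intro allI borel_integrable_atLeastAtMost' continuous_on_subset[OF assms]) auto

lemma locally_integrable_real_diff:
  "locally_integrable_real f \<Longrightarrow> locally_integrable_real g \<Longrightarrow> locally_integrable_real (\<lambda>t. f t - g t)"
  by (simp add: locally_integrable_real_def set_integral_diff)

lemma integrable_mult_bump:
  assumes f: "locally_integrable_real f" and "bump_on r \<psi>"
  shows "integrable lborel (\<lambda>t. f t * \<psi> t)"
proof -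
  obtain B where B: "B \<ge> 0" "\<And>t. \<bar>\<psi> t\<bar> \<le> B * indicator {-r..r} t"
    using bump_on_bounded[OF assms(2)] by blast
  have [measurable]: "f \<in> borel_measurable borel" by (rule locally_integrable_real_measurable[OF f])
  have [measurable]: "\<psi> \<in> borel_measurable borel"
    using assms(2) by (simp add: bump_on_def smooth_fun_measurable)
  show ?thesis
  proof (rule Bochner_Integration.integrable_bound)
    show "integrable lborel (\<lambda>t. B * (indicator {-r..r} t * f t))"
      using f by (intro integrable_mult_right) (simp add: locally_integrable_real_def set_integrable_def)
    show "AE t in lborel. norm (f t * \<psi> t) \<le> norm (B * (indicator {-r..r} t * f t))"
    proof (rule AE_I2)
      fix t
      show "norm (f t * \<psi> t) \<le> norm (B * (indicator {-r..r} t * f t))"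
        using mult_left_mono[OF B(2)[of t], of "\<bar>f t\<bar>"] B(1) by (simp add: abs_mult mult_ac)
    qed
  qed measurable
qed

lemma integrable_bump:
  assumes "bump_on r \<psi>"
  shows "integrable lborel \<psi>"
  using integrable_mult_bump[of "\<lambda>_. 1", OF locally_integrable_real_continuous assms] by simp

lemma integral_deriv_Icc:
  assumes "smooth_fun f" "a \<le> b"
  shows "(\<integral>t. deriv f t * indicator {a..b} t \<partial>lborel) = f b - f a"
proof (rule integral_FTC_Icc_real[OF assms(2)])
  show "DERIV f x :> deriv f x" for x by (rule smooth_fun_deriv(2)[OF assms(1)])
  show "isCont (deriv f) x" for x
    using smooth_fun_continuous[OF smooth_fun_deriv(1)[OF assms(1)], of UNIV]
    by (simp add: continuous_on_eq_continuous_at)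
qed

text \<open>
Mean zero is exactly the condition under which the antiderivative that vanishes on the left of the support
also vanishes on the right of it.
\<close>

lemma bump_antiderivative:
  assumes \<psi>: "bump_on r \<psi>" and r: "r \<ge> 0" and zero: "(\<integral>t. \<psi> t \<partial>lborel) = 0"
  shows "\<exists>\<phi>. bump_on r \<phi> \<and> deriv \<phi> = \<psi>"
proof -
  have smooth: "smooth_fun \<psi>" and supp: "\<And>t. \<psi> t \<noteq> 0 \<Longrightarrow> \<bar>t\<bar> \<le> r"
    using \<psi> by (auto simp: bump_on_def)
  have "\<exists>F. \<forall>x::real. -\<infinity> < ereal x \<longrightarrow> ereal x < \<infinity> \<longrightarrow> (F has_vector_derivative \<psi> x) (at x)"
    using smooth_fun_continuous[OF smooth, of UNIV]
    by (intro einterval_antiderivative) (auto simp: continuous_on_eq_continuous_at)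
  then obtain F where F: "\<And>x. (F has_real_derivative \<psi> x) (at x)"
    by (auto simp: has_real_derivative_iff_has_vector_derivative)
  \<comment> \<open>The base point lies strictly to the left of the support, so that integrals up to the left of it vanish pointwise.\<close>
  define \<phi> where "\<phi> t = F t - F (- r - 1)" for t
  have \<phi>': "(\<phi> has_real_derivative \<psi> t) (at t)" for t
    unfolding \<phi>_def[abs_def] by (auto intro!: derivative_eq_intros F)
  have deriv: "deriv \<phi> = \<psi>" using \<phi>' by (auto intro: DERIV_imp_deriv)
  have smooth_\<phi>: "smooth_fun \<phi>" using \<phi>' smooth by (rule smooth_fun.antideriv)
  note FTC = integral_deriv_Icc[OF smooth_\<phi>, unfolded deriv]
  have [simp]: "\<phi> (- r - 1) = 0" by (simp add: \<phi>_def)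
  have "\<phi> t = 0" if t: "\<not> \<bar>t\<bar> \<le> r" for t
  proof -
    consider "t \<le> - r - 1" | "- r - 1 < t" "t < - r" | "r < t" using t by linarith
    then show ?thesis
    proof cases
      case 1
      have "(\<lambda>s. \<psi> s * indicator {t..-r-1} s) = (\<lambda>_. 0)"
        using supp r by (force simp: indicator_def)
      then show ?thesis using FTC[OF 1] by simp
    next
      case 2
      have "(\<lambda>s. \<psi> s * indicator {-r-1..t} s) = (\<lambda>_. 0)"
        using supp 2 by (force simp: indicator_def)
      then show ?thesis using FTC[of "-r-1" t] 2 by simp
    next
      case 3
      have "(\<lambda>s. \<psi> s * indicator {-r-1..t} s) = \<psi>"
        using supp 3 by (force simp: indicator_def)
      then show ?thesis using FTC[of "-r-1" t] 3 r zero by simp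
    qed
  qed
  then have "bump_on r \<phi>" using smooth_\<phi> by (auto simp: bump_on_def)
  with deriv show ?thesis by blast
qed

text \<open>
The integral of \<open>g\<close> from \<open>0\<close> to \<open>t\<close>, written with a signed kernel so that both signs of \<open>t\<close> are treated at
once and Fubini's theorem applies to the kernel.
\<close>

definition primitive :: "(real \<Rightarrow> real) \<Rightarrow> real \<Rightarrow> real" where
  "primitive g t = (\<integral>s. (indicator {0..<t} s - indicator {t..<0} s) * g s \<partial>lborel)"

lemma integrable_indicator_mult:
  assumes "locally_integrable_real g" "A \<in> sets borel" "A \<subseteq> {-r..r}"
  shows "integrable lborel (\<lambda>s. indicator A s * g s)"
proof -
  have "set_integrable lborel A g"
    by (rule set_integrable_subset[where A = "{-r..r}"])
      (use assms in \<open>auto simp: locally_integrable_real_def\<close>)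
  then show ?thesis by (simp add: set_integrable_def)
qed

lemma primitive_diff:
  assumes g: "locally_integrable_real g" and "s \<le> t"
  shows "primitive g t - primitive g s = (\<integral>u. indicator {s..<t} u * g u \<partial>lborel)"
proof -
  define r where "r = max \<bar>s\<bar> \<bar>t\<bar>"
  have int: "integrable lborel (\<lambda>u. indicator {a..<b} u * g u)" if "\<bar>a\<bar> \<le> r" "\<bar>b\<bar> \<le> r" for a b
    using that by (intro integrable_indicator_mult[OF g, of _ r]) auto
  have r: "\<bar>s\<bar> \<le> r" "\<bar>t\<bar> \<le> r" "\<bar>0\<bar> \<le> r" by (auto simp: r_def)
  have k: "integrable lborel (\<lambda>u. (indicator {0..<x} u - indicator {x..<0} u) * g u)" if "\<bar>x\<bar> \<le> r" for x
    unfolding left_diff_distrib using that r by (intro Bochner_Integration.integrable_diff int)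
  have "primitive g t - primitive g s
      = (\<integral>u. (indicator {0..<t} u - indicator {t..<0} u) * g u - (indicator {0..<s} u - indicator {s..<0} u) * g u \<partial>lborel)"
    unfolding primitive_def using k r by simp
  also have "\<dots> = (\<integral>u. indicator {s..<t} u * g u \<partial>lborel)"
    using \<open>s \<le> t\<close> by (intro Bochner_Integration.integral_cong) (auto simp: indicator_def)
  finally show ?thesis .
qed

lemma continuous_primitive:
  assumes g: "locally_integrable_real g"
  shows "continuous_on UNIV (primitive g)"
proof -
  have cont: "continuous_on {-r..r} (primitive g)" for r
  proof -
    have int: "set_integrable lborel {-r..r} g" using g by (simp add: locally_integrable_real_def)
    have eq: "primitive g t = primitive g (-r) + integral {-r..t} g" if "t \<in> {-r..r}" for t
    proof -
      have "set_integrable lborel {-r..t} g"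
        by (rule set_integrable_subset[OF int]) (use that in auto)
      then have "integral {-r..t} g = (\<integral>u. indicator {-r..t} u * g u \<partial>lborel)"
        by (simp add: set_borel_integral_eq_integral(2)[symmetric] set_lebesgue_integral_def)
      also have "\<dots> = (\<integral>u. indicator {-r..<t} u * g u \<partial>lborel)"
      proof (rule integral_cong_AE)
        show "AE u in lborel. indicator {-r..t} u * g u = indicator {-r..<t} u * g u"
          using AE_lborel_singleton[of t] by eventually_elim (auto simp: indicator_def)
      qed (use locally_integrable_real_measurable[OF g] in auto)
      finally show ?thesis using primitive_diff[OF g, of "-r" t] that by simp
    qed
    have "continuous_on {-r..r} (\<lambda>t. primitive g (-r) + integral {-r..t} g)"
      using set_borel_integral_eq_integral(1)[OF int]
      by (intro continuous_on_add continuous_on_const indefinite_integral_continuous_1)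
    then show ?thesis by (rule continuous_on_eq) (rule eq[symmetric])
  qed
  show ?thesis
    unfolding continuous_on_eq_continuous_at[OF open_UNIV]
  proof
    fix x :: real
    show "isCont (primitive g) x"
      by (rule continuous_on_interior[OF cont[of "\<bar>x\<bar> + 1"]]) auto
  qed
qed

text \<open>
Integration by parts for a primitive that is merely absolutely continuous: exchange the order of integration
and apply the fundamental theorem of calculus to the smooth factor.
\<close>

lemma integral_primitive_mult_deriv:
  assumes g: "locally_integrable_real g" and \<phi>: "bump_on r \<phi>"
  shows "(\<integral>t. primitive g t * deriv \<phi> t \<partial>lborel) = - (\<integral>t. g t * \<phi> t \<partial>lborel)"
proof -
  have smooth: "smooth_fun \<phi>" using \<phi> by (simp add: bump_on_def)
  have \<phi>': "bump_on r (deriv \<phi>)" by (rule bump_on_deriv[OF \<phi>])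
  have [measurable]: "g \<in> borel_measurable borel" by (rule locally_integrable_real_measurable[OF g])
  have [measurable]: "deriv \<phi> \<in> borel_measurable borel"
    by (intro smooth_fun_measurable smooth_fun_deriv smooth)
  define k :: "real \<Rightarrow> real \<Rightarrow> real" where "k t s = indicator {0..<t} s - indicator {t..<0} s" for t s
  have k_alt: "k t s = (if 0 \<le> s \<and> s < t then 1 else 0) - (if t \<le> s \<and> s < 0 then 1 else 0)" for t s
    by (simp add: k_def indicator_def)
  have k_meas [measurable]: "(\<lambda>(t, s). k t s) \<in> borel_measurable (lborel \<Otimes>\<^sub>M lborel)"
    unfolding k_alt[abs_def] by measurable
  have dom: "integrable (lborel \<Otimes>\<^sub>M lborel) (\<lambda>(t, s). \<bar>deriv \<phi> t\<bar> * \<bar>indicator {-r..r} s * g s\<bar>)"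
  proof (rule lborel_pair.Fubini_integrable)
    show "integrable lborel (\<lambda>x. \<integral>y. norm (case (x, y) of (t, s) \<Rightarrow> \<bar>deriv \<phi> t\<bar> * \<bar>indicator {-r..r} s * g s\<bar>) \<partial>lborel)"
      using integrable_bump[OF \<phi>'] by (simp add: abs_mult)
    show "AE x in lborel. integrable lborel (\<lambda>y. case (x, y) of (t, s) \<Rightarrow> \<bar>deriv \<phi> t\<bar> * \<bar>indicator {-r..r} s * g s\<bar>)"
      using g by (auto simp: locally_integrable_real_def set_integrable_def intro!: integrable_mult_right integrable_abs)
  qed measurable
  have int: "integrable (lborel \<Otimes>\<^sub>M lborel) (\<lambda>(t, s). k t s * g s * deriv \<phi> t)"
  proof (rule Bochner_Integration.integrable_bound[OF dom])
    show "AE x in lborel \<Otimes>\<^sub>M lborel. norm (case x of (t, s) \<Rightarrow> k t s * g s * deriv \<phi> t)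
        \<le> norm (case x of (t, s) \<Rightarrow> \<bar>deriv \<phi> t\<bar> * \<bar>indicator {-r..r} s * g s\<bar>)"
    proof (rule AE_I2, clarify)
      fix t s :: real
      show "norm (k t s * g s * deriv \<phi> t) \<le> norm (\<bar>deriv \<phi> t\<bar> * \<bar>indicator {-r..r} s * g s\<bar>)"
      proof (cases "deriv \<phi> t = 0 \<or> k t s = 0")
        case False
        then have "\<bar>t\<bar> \<le> r" using \<phi>' by (auto simp: bump_on_def)
        then have "s \<in> {-r..r}" "\<bar>k t s\<bar> = 1" using False by (auto simp: k_alt split: if_splits)
        then show ?thesis by (simp add: abs_mult)
      qed auto
    qed
  qed measurable
  have inner: "(\<integral>t. k t s * deriv \<phi> t \<partial>lborel) = - \<phi> s" for s
  proof (cases "s \<ge> 0")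
    case True
    define b where "b = \<bar>r\<bar> + \<bar>s\<bar> + 1"
    have "(\<integral>t. k t s * deriv \<phi> t \<partial>lborel) = (\<integral>t. deriv \<phi> t * indicator {s..b} t \<partial>lborel)"
    proof (rule integral_cong_AE)
      show "AE t in lborel. k t s * deriv \<phi> t = deriv \<phi> t * indicator {s..b} t"
        using AE_lborel_singleton[of s]
      proof eventually_elim
        fix t assume "t \<noteq> s"
        then show "k t s * deriv \<phi> t = deriv \<phi> t * indicator {s..b} t"
          using True \<phi>' by (cases "deriv \<phi> t = 0") (auto simp: k_alt indicator_def bump_on_def b_def)
      qed
    qed measurable
    also have "\<dots> = \<phi> b - \<phi> s" using integral_deriv_Icc[OF smooth, of s b] by (simp add: b_def)
    also have "\<phi> b = 0" using \<phi> by (force simp: bump_on_def b_def)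
    finally show ?thesis by simp
  next
    case False
    define a where "a = - \<bar>r\<bar> - \<bar>s\<bar> - 1"
    have "(\<integral>t. k t s * deriv \<phi> t \<partial>lborel) = (\<integral>t. - (deriv \<phi> t * indicator {a..s} t) \<partial>lborel)"
    proof (intro Bochner_Integration.integral_cong refl)
      fix t
      show "k t s * deriv \<phi> t = - (deriv \<phi> t * indicator {a..s} t)"
        using False \<phi>' by (cases "deriv \<phi> t = 0") (auto simp: k_alt indicator_def bump_on_def a_def)
    qed
    also have "\<dots> = - (\<phi> s - \<phi> a)" using integral_deriv_Icc[OF smooth, of a s] by (simp add: a_def)
    also have "\<phi> a = 0" using \<phi> by (force simp: bump_on_def a_def)
    finally show ?thesis by simp
  qed
  have "(\<integral>t. primitive g t * deriv \<phi> t \<partial>lborel) = (\<integral>t. \<integral>s. k t s * g s * deriv \<phi> t \<partial>lborel \<partial>lborel)"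
    by (simp add: primitive_def k_def)
  also have "\<dots> = (\<integral>s. \<integral>t. k t s * g s * deriv \<phi> t \<partial>lborel \<partial>lborel)"
    using lborel_pair.Fubini_integral[OF int] by simp
  also have "\<dots> = (\<integral>s. g s * (\<integral>t. k t s * deriv \<phi> t \<partial>lborel) \<partial>lborel)"
    by (intro Bochner_Integration.integral_cong refl) (subst integral_mult_right_zero[symmetric], simp add: mult_ac)
  also have "\<dots> = - (\<integral>t. g t * \<phi> t \<partial>lborel)"
    unfolding inner by simp
  finally show ?thesis .
qed

text \<open>
A fixed bump of integral one; subtracting multiples of it gives other bumps mean zero.
\<close>

definition unit_bump :: "real \<Rightarrow> real" where
  "unit_bump t = bump 0 0 1 t / (\<integral>s. bump 0 0 1 s \<partial>lborel)"

lemma integral_bump_pos: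
  "(\<integral>s. bump 0 0 1 s \<partial>lborel) > 0"
proof -
  have int: "integrable lborel (bump 0 0 1)" by (rule integrable_bump[OF bump_on_bump])
  have "(\<integral>s. bump 0 0 1 s \<partial>lborel) \<noteq> 0"
  proof
    assume "(\<integral>s. bump 0 0 1 s \<partial>lborel) = 0"
    then have "AE s in lborel. bump 0 0 1 s = 0"
      using integral_nonneg_eq_0_iff_AE[OF int] by (simp add: bump_bounds)
    then have "AE s in lborel. s \<notin> {0<..<1::real}"
    proof eventually_elim
      fix s assume "bump 0 0 1 s = 0"
      then show "s \<notin> {0<..<1::real}" by (auto simp: bump_def flat_def)
    qed
    then have "emeasure lborel {0<..<1::real} = 0"
      by (subst (asm) AE_iff_measurable[of "{0<..<1}"]) auto
    then show False by simp
  qed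
  moreover have "(\<integral>s. bump 0 0 1 s \<partial>lborel) \<ge> 0"
    by (intro Bochner_Integration.integral_nonneg bump_bounds)
  ultimately show ?thesis by linarith
qed

lemma bump_on_cmult_add:
  assumes "bump_on r f" "bump_on r g"
  shows "bump_on r (\<lambda>t. f t + c * g t)"
  unfolding bump_on_def
proof (intro conjI allI impI)
  show "smooth_fun (\<lambda>t. f t + c * g t)"
    using assms by (intro smooth_fun.add smooth_fun.mult smooth_fun.const) (auto simp: bump_on_def)
  fix t assume "f t + c * g t \<noteq> 0"
  then have "f t \<noteq> 0 \<or> g t \<noteq> 0" by auto
  then show "\<bar>t\<bar> \<le> r" using assms by (auto simp: bump_on_def)
qed

lemma bump_on_unit_bump: "bump_on 1 unit_bump"
proof -
  have "smooth_fun (\<lambda>t. inverse (\<integral>s. bump 0 0 1 s \<partial>lborel) * bump 0 0 1 t)"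
    by (intro smooth_fun.mult smooth_fun.const smooth_fun_bump)
  then show ?thesis
    using bump_on_bump[of 0 1 0]
    by (auto simp: bump_on_def unit_bump_def[abs_def] divide_inverse mult.commute)
qed

lemma integral_unit_bump: "(\<integral>t. unit_bump t \<partial>lborel) = 1"
  using integral_bump_pos by (simp add: unit_bump_def[abs_def])

text \<open>
Every bump, corrected by a multiple of the unit bump to have mean zero, is the derivative of a test function.
A countable supply is enough for rational intervals.
\<close>

lemma countable_test_family:
  obtains \<Phi> :: "(real \<Rightarrow> real) set" where "countable \<Phi>" "\<And>\<phi>. \<phi> \<in> \<Phi> \<Longrightarrow> \<exists>r. bump_on r \<phi>"
    "\<And>a b k. a \<in> \<rat> \<Longrightarrow> b \<in> \<rat> \<Longrightarrow>
       \<exists>\<phi>\<in>\<Phi>. \<forall>t. deriv \<phi> t = bump k a b t - (\<integral>s. bump k a b s \<partial>lborel) * unit_bump t"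
proof -
  have "\<exists>\<phi> r. bump_on r \<phi> \<and> deriv \<phi> = (\<lambda>t. bump k a b t - (\<integral>s. bump k a b s \<partial>lborel) * unit_bump t)" for k a b
  proof -
    let ?I = "\<integral>s. bump k a b s \<partial>lborel"
    define r where "r = max 1 (max \<bar>a\<bar> \<bar>b\<bar>)"
    have on: "bump_on r (bump k a b)" "bump_on r unit_bump"
      by (auto intro!: bump_on_mono[OF bump_on_bump] bump_on_mono[OF bump_on_unit_bump] simp: r_def)
    have "bump_on r (\<lambda>t. bump k a b t - ?I * unit_bump t)"
      using bump_on_cmult_add[OF on, of "- ?I"] by simp
    moreover have "(\<integral>t. bump k a b t - ?I * unit_bump t \<partial>lborel) = 0"
      using integrable_bump[OF on(1)] integrable_bump[OF on(2)] by (simp add: integral_unit_bump)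
    ultimately show ?thesis
      using bump_antiderivative[of r "\<lambda>t. bump k a b t - ?I * unit_bump t"] by (fastforce simp: r_def)
  qed
  then obtain \<phi> where \<phi>: "\<And>k a b. \<exists>r. bump_on r (\<phi> k a b)"
      "\<And>k a b. deriv (\<phi> k a b) = (\<lambda>t. bump k a b t - (\<integral>s. bump k a b s \<partial>lborel) * unit_bump t)"
    by metis
  show ?thesis
  proof (rule that[of "(\<lambda>(k, a, b). \<phi> k a b) ` (UNIV \<times> \<rat> \<times> \<rat>)"])
    show "countable ((\<lambda>(k, a, b). \<phi> k a b) ` (UNIV \<times> \<rat> \<times> \<rat>))"
      by (intro countable_image countable_SIGMA) (auto simp: countable_rat)
    show "\<exists>\<phi>'\<in>(\<lambda>(k, a, b). \<phi> k a b) ` (UNIV \<times> \<rat> \<times> \<rat>).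
        \<forall>t. deriv \<phi>' t = bump k a b t - (\<integral>s. bump k a b s \<partial>lborel) * unit_bump t"
      if "a \<in> \<rat>" "b \<in> \<rat>" for a b k
      using that by (intro bexI[of _ "\<phi> k a b"]) (auto simp: \<phi>(2) image_iff)
  qed (use \<phi>(1) in auto)
qed

text \<open>
The lemma of du Bois-Reymond. The difference \<open>u\<close> of \<open>v\<close> and the primitive of \<open>g\<close> is orthogonal to the
derivatives of test functions, that is, to bumps of mean zero. Hence \<open>u\<close> minus its average against the unit
bump is orthogonal to all bumps.
\<close>

lemma AE_eq_primitive_if_weak_derivative:
  assumes v: "locally_integrable_real v" and g: "locally_integrable_real g"
    and weak: "\<And>\<phi>. \<phi> \<in> \<Phi> \<Longrightarrow> (\<integral>t. v t * deriv \<phi> t + g t * \<phi> t \<partial>lborel) = 0"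
    and bumps: "\<And>\<phi>. \<phi> \<in> \<Phi> \<Longrightarrow> \<exists>r. bump_on r \<phi>"
    and rich: "\<And>a b k. a \<in> \<rat> \<Longrightarrow> b \<in> \<rat> \<Longrightarrow>
       \<exists>\<phi>\<in>\<Phi>. \<forall>t. deriv \<phi> t = bump k a b t - (\<integral>s. bump k a b s \<partial>lborel) * unit_bump t"
  shows "\<exists>m. AE t in lborel. v t = m + primitive g t"
proof -
  define u where "u t = v t - primitive g t" for t
  have prim: "locally_integrable_real (primitive g)"
    by (intro locally_integrable_real_continuous continuous_primitive g)
  have u: "locally_integrable_real u"
    unfolding u_def[abs_def] by (intro locally_integrable_real_diff v prim)
  \<comment> \<open>The only constant that makes the difference orthogonal to the unit bump, which has integral one.\<close>
  define m where "m = (\<integral>t. u t * unit_bump t \<partial>lborel)"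
  define w where "w t = u t - m" for t
  have w: "locally_integrable_real w"
    unfolding w_def[abs_def] by (intro locally_integrable_real_diff u locally_integrable_real_continuous) auto
  have [measurable]: "w \<in> borel_measurable borel" by (rule locally_integrable_real_measurable[OF w])
  have orth: "(\<integral>t. w t * bump k a b t \<partial>lborel) = 0" if rat: "a \<in> \<rat>" "b \<in> \<rat>" for a b k
  proof -
    let ?I = "\<integral>s. bump k a b s \<partial>lborel"
    obtain \<phi> r where \<phi>: "\<phi> \<in> \<Phi>" "bump_on r \<phi>" "\<And>t. deriv \<phi> t = bump k a b t - ?I * unit_bump t"
      using rich[OF rat, of k] bumps by blast
    have \<phi>': "bump_on r (deriv \<phi>)" by (rule bump_on_deriv[OF \<phi>(2)])
    have u\<rho>: "integrable lborel (\<lambda>t. u t * unit_bump t)" by (rule integrable_mult_bump[OF u bump_on_unit_bump])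
    have "(\<integral>t. w t * bump k a b t \<partial>lborel) = (\<integral>t. u t * deriv \<phi> t + ?I * (u t * unit_bump t) - m * bump k a b t \<partial>lborel)"
      by (intro Bochner_Integration.integral_cong) (auto simp: w_def \<phi>(3) algebra_simps)
    also have "\<dots> = (\<integral>t. u t * deriv \<phi> t \<partial>lborel)"
      using u\<rho> integrable_mult_bump[OF u \<phi>'] integrable_bump[OF bump_on_bump, of k a b]
      by (simp add: m_def[symmetric])
    also have "\<dots> = (\<integral>t. v t * deriv \<phi> t - primitive g t * deriv \<phi> t \<partial>lborel)"
      by (simp add: u_def left_diff_distrib)
    also have "\<dots> = (\<integral>t. v t * deriv \<phi> t + g t * \<phi> t \<partial>lborel)"
      using integrable_mult_bump[OF v \<phi>'] integrable_mult_bump[OF prim \<phi>'] integrable_mult_bump[OF g \<phi>(2)]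
      by (simp add: integral_primitive_mult_deriv[OF g \<phi>(2)])
    finally show ?thesis using weak[OF \<phi>(1)] by simp
  qed
  have "AE t in lborel. w t = 0"
  proof (rule AE_zero_if_zero_on_generator[OF lborel.sigma_finite_measure_axioms _ Int_stable_rat_intervals])
    show "sets lborel = sigma_sets (space lborel) rat_intervals"
      by (simp add: borel_eq_sigma_rat_intervals)
    show "range (\<lambda>k. {- real k<..<real k}) \<subseteq> rat_intervals" using symmetric_interval_rat by blast
    show "(\<Union>k. {- real k<..<real k}) = space lborel" by (simp add: UN_symmetric_interval)
    fix X assume "X \<in> rat_intervals"
    then obtain a b where ab: "a \<in> \<rat>" "b \<in> \<rat>" and X: "X = {a<..<b}" by (rule rat_intervalsE)
    show int: "integrable lborel (\<lambda>t. indicator X t * w t)"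
      by (rule integrable_indicator_mult[OF w, of _ "max \<bar>a\<bar> \<bar>b\<bar>"]) (auto simp: X)
    have [measurable]: "bump k a b \<in> borel_measurable borel" for k
      by (intro smooth_fun_measurable smooth_fun_bump)
    have "(\<lambda>k. \<integral>t. w t * bump k a b t \<partial>lborel) \<longlonglongrightarrow> (\<integral>t. indicator X t * w t \<partial>lborel)"
    proof (rule integral_dominated_convergence[where w = "\<lambda>t. \<bar>indicator X t * w t\<bar>"])
      show "AE t in lborel. (\<lambda>k. w t * bump k a b t) \<longlonglongrightarrow> indicator X t * w t"
      proof (rule AE_I2)
        fix t show "(\<lambda>k. w t * bump k a b t) \<longlonglongrightarrow> indicator X t * w t"
          unfolding X by (subst mult.commute) (intro tendsto_mult_left bump_tendsto_indicator)
      qed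
      show "AE t in lborel. norm (w t * bump k a b t) \<le> \<bar>indicator X t * w t\<bar>" for k
      proof (rule AE_I2)
        fix t show "norm (w t * bump k a b t) \<le> \<bar>indicator X t * w t\<bar>"
          using mult_left_mono[OF bump_bounds(2)[of k a b t], of "\<bar>w t\<bar>"] bump_bounds(1)[of k a b t]
          by (simp add: abs_mult X mult.commute)
      qed
    qed (use int in \<open>auto simp: X\<close>)
    then show "(\<integral>t. indicator X t * w t \<partial>lborel) = 0"
      using orth[OF ab] by (simp add: LIMSEQ_const_iff)
  qed auto
  then show ?thesis
    by (intro exI[of _ m]) (auto simp: w_def u_def)
qed

text \<open>
With \<open>u t = m + primitive g t\<close>, the image under \<open>u\<close> of the measure with density \<open>g\<close> is Lebesgue measure:
\<open>u\<close> is an increasing homeomorphism, so the preimage of an interval is an interval, and its mass is the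
increment of \<open>u\<close> over it.
\<close>

lemma nn_integral_substitution_primitive:
  assumes g: "locally_integrable_real g" and c: "c > 0" "AE t in lborel. g t > c"
    and f [measurable]: "f \<in> borel_measurable borel"
  shows "(\<integral>\<^sup>+t. f (m + primitive g t) * ennreal (g t) \<partial>lborel) = (\<integral>\<^sup>+y. f y \<partial>lborel)"
proof -
  have [measurable]: "g \<in> borel_measurable borel" by (rule locally_integrable_real_measurable[OF g])
  define u where "u t = m + primitive g t" for t
  have cont: "continuous_on UNIV u"
    unfolding u_def[abs_def] by (intro continuous_intros continuous_primitive g)
  have [measurable]: "u \<in> borel_measurable borel"
    by (rule borel_measurable_continuous_onI[OF cont])
  have int: "integrable lborel (\<lambda>x. indicator {s..<t} x * g x)" for s t
    by (rule integrable_indicator_mult[OF g, of _ "max \<bar>s\<bar> \<bar>t\<bar>"]) auto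
  have diff: "u t - u s = (\<integral>x. indicator {s..<t} x * g x \<partial>lborel)" if "s \<le> t" for s t
    using primitive_diff[OF g that] by (simp add: u_def)
  \<comment> \<open>The lower bound on the slope gives surjectivity as well as strict monotonicity.\<close>
  have growth: "c * (t - s) \<le> u t - u s" if "s \<le> t" for s t
  proof -
    have "c * (t - s) = (\<integral>x. indicator {s..<t} x * c \<partial>lborel)" using that by simp
    also have "\<dots> \<le> u t - u s"
      unfolding diff[OF that]
    proof (rule integral_mono_AE[OF _ int])
      show "integrable lborel (\<lambda>x. indicator {s..<t} x * c)"
        by (intro integrable_mult_left integrable_real_indicator) (auto simp: that)
      show "AE x in lborel. indicator {s..<t} x * c \<le> indicator {s..<t} x * g x"
        using c(2) by eventually_elim (auto simp: indicator_def)
    qed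
    finally show ?thesis .
  qed
  have strict: "u s < u t" if "s < t" for s t
    using growth[of s t] that c(1) mult_pos_pos[of c "t - s"] by linarith
  have less_iff: "u s < u t \<longleftrightarrow> s < t" for s t
    using strict[of s t] strict[of t s] by (cases s t rule: linorder_cases) auto
  have surj: "\<exists>t. u t = y" for y
  proof -
    define T where "T = \<bar>y - u 0\<bar> / c"
    have T: "T \<ge> 0" "c * T = \<bar>y - u 0\<bar>" using c(1) by (auto simp: T_def)
    have "u (- T) \<le> y" "y \<le> u T" using growth[of "-T" 0] growth[of 0 T] T by auto
    then show ?thesis
      using IVT'[of u "-T" y T] T continuous_on_subset[OF cont] by auto
  qed
  have "lborel = distr (density lborel (\<lambda>t. ennreal (g t))) borel u"
  proof (rule lborel_eqI)
    fix l r :: real assume "\<And>b. b \<in> Basis \<Longrightarrow> l \<bullet> b \<le> r \<bullet> b"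
    then have lr: "l \<le> r" by simp
    obtain a b where ab: "u a = l" "u b = r" using surj[of l] surj[of r] by blast
    then have "a \<le> b" using lr strict[of b a] by linarith
    have vimage: "u -` {l<..<r} = {a<..<b}"
      using ab by (auto simp: less_iff)
    have "emeasure (distr (density lborel (\<lambda>t. ennreal (g t))) borel u) (box l r)
        = (\<integral>\<^sup>+t. ennreal (g t) * indicator {a<..<b} t \<partial>lborel)"
      by (subst emeasure_distr) (auto simp: vimage emeasure_density)
    also have "\<dots> = (\<integral>\<^sup>+t. ennreal (indicator {a..<b} t * g t) \<partial>lborel)"
      using AE_lborel_singleton[of a] by (intro nn_integral_cong_AE) (auto elim!: eventually_mono simp: indicator_def)
    also have "\<dots> = ennreal (r - l)"
    proof (subst nn_integral_eq_integral[OF int])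
      show "AE x in lborel. 0 \<le> indicator {a..<b} x * g x"
        using c(2) by eventually_elim (use c(1) in \<open>auto simp: indicator_def\<close>)
    qed (use diff[OF \<open>a \<le> b\<close>] ab in simp)
    finally show "emeasure (distr (density lborel (\<lambda>t. ennreal (g t))) borel u) (box l r) = (\<Prod>b\<in>Basis. (r - l) \<bullet> b)"
      by simp
  qed simp
  then have "(\<integral>\<^sup>+y. f y \<partial>lborel) = (\<integral>\<^sup>+y. f y \<partial>distr (density lborel (\<lambda>t. ennreal (g t))) borel u)"
    by (rule arg_cong)
  also have "\<dots> = (\<integral>\<^sup>+t. ennreal (g t) * f (u t) \<partial>lborel)"
    by (subst nn_integral_distr) (auto simp: nn_integral_density)
  finally show ?thesis by (simp add: u_def mult.commute)
qed

section \<open>Slices in the direction of the last coordinate\<close>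

lemma lebesgue_Rn_Suc: "lebesgue_Rn (Suc n) = PiM (insert (Suc n) {1..n}) (\<lambda>_. lborel)"
  by (simp add: lebesgue_Rn_def atLeastAtMostSuc_conv)

lemma measurable_append [measurable]:
  "(\<lambda>(x, t). x(Suc n := t)) \<in> measurable (lebesgue_Rn n \<Otimes>\<^sub>M lborel) (lebesgue_Rn (Suc n))"
  unfolding lebesgue_Rn_Suc unfolding lebesgue_Rn_def by (rule measurable_add_dim)

lemma measurable_append_section:
  assumes "f \<in> borel_measurable (lebesgue_Rn (Suc n))" "x \<in> Rn n"
  shows "(\<lambda>t. f (x(Suc n := t))) \<in> borel_measurable borel"
proof -
  have "(\<lambda>p. f ((\<lambda>(x, t). x(Suc n := t)) p)) \<in> borel_measurable (lebesgue_Rn n \<Otimes>\<^sub>M lborel)"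
    by (rule measurable_compose[OF measurable_append assms(1)])
  from measurable_Pair2[OF this, of x] assms(2) show ?thesis by simp
qed

lemma nn_integral_lebesgue_Rn_Suc:
  assumes "f \<in> borel_measurable (lebesgue_Rn (Suc n))"
  shows "(\<integral>\<^sup>+x. f x \<partial>lebesgue_Rn (Suc n)) = (\<integral>\<^sup>+x. \<integral>\<^sup>+t. f (x(Suc n := t)) \<partial>lborel \<partial>lebesgue_Rn n)"
  using lborel_family.product_nn_integral_insert[of "{1..n}" "Suc n" f] assms
  by (simp add: lebesgue_Rn_Suc) (simp add: lebesgue_Rn_def)

text \<open>
Realising the higher-dimensional measure as an image of a binary product makes Fubini's theorem for pairs
available.
\<close>

lemma lebesgue_Rn_Suc_eq_distr:
  "lebesgue_Rn (Suc n) = distr (lebesgue_Rn n \<Otimes>\<^sub>M lborel) (lebesgue_Rn (Suc n)) (\<lambda>(x, t). x(Suc n := t))"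
proof (rule measure_eqI)
  fix A assume A [measurable]: "A \<in> sets (lebesgue_Rn (Suc n))"
  have "emeasure (distr (lebesgue_Rn n \<Otimes>\<^sub>M lborel) (lebesgue_Rn (Suc n)) (\<lambda>(x, t). x(Suc n := t))) A
      = (\<integral>\<^sup>+x. indicator A x \<partial>distr (lebesgue_Rn n \<Otimes>\<^sub>M lborel) (lebesgue_Rn (Suc n)) (\<lambda>(x, t). x(Suc n := t)))"
    by (rule nn_integral_indicator[symmetric]) simp
  also have "\<dots> = (\<integral>\<^sup>+p. indicator A ((\<lambda>(x, t). x(Suc n := t)) p) \<partial>(lebesgue_Rn n \<Otimes>\<^sub>M lborel))"
    by (rule nn_integral_distr[OF measurable_append]) simp
  also have "\<dots> = (\<integral>\<^sup>+x. \<integral>\<^sup>+t. indicator A (x(Suc n := t)) \<partial>lborel \<partial>lebesgue_Rn n)"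
    by (subst lborel.nn_integral_fst[symmetric]) (auto intro: measurable_compose[OF measurable_append])
  also have "\<dots> = emeasure (lebesgue_Rn (Suc n)) A"
    using nn_integral_lebesgue_Rn_Suc[of "indicator A" n] by simp
  finally show "emeasure (lebesgue_Rn (Suc n)) A
      = emeasure (distr (lebesgue_Rn n \<Otimes>\<^sub>M lborel) (lebesgue_Rn (Suc n)) (\<lambda>(x, t). x(Suc n := t))) A" by simp
qed simp

lemma pair_sigma_finite_lebesgue_Rn_lborel: "pair_sigma_finite (lebesgue_Rn n) (lborel :: real measure)"
  by (intro pair_sigma_finite.intro sigma_finite_lebesgue_Rn lborel.sigma_finite_measure_axioms)

lemma AE_slice:
  assumes "AE x in lebesgue_Rn (Suc n). P x"
  shows "AE x in lebesgue_Rn n. AE t in lborel. P (x(Suc n := t))"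
proof -
  interpret pair_sigma_finite "lebesgue_Rn n" "lborel :: real measure"
    by (rule pair_sigma_finite_lebesgue_Rn_lborel)
  have "AE p in lebesgue_Rn n \<Otimes>\<^sub>M lborel. P ((\<lambda>(x, t). x(Suc n := t)) p)"
    by (rule AE_distrD[OF measurable_append], subst lebesgue_Rn_Suc_eq_distr[symmetric]) (rule assms)
  from AE_pair[OF this] show ?thesis by simp
qed

lemma
  fixes f :: "(nat \<Rightarrow> real) \<Rightarrow> real"
  assumes "integrable (lebesgue_Rn (Suc n)) f"
  shows AE_integrable_slice: "AE x in lebesgue_Rn n. integrable lborel (\<lambda>t. f (x(Suc n := t)))"
    and integrable_slice_integral: "integrable (lebesgue_Rn n) (\<lambda>x. \<integral>t. f (x(Suc n := t)) \<partial>lborel)"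
    and integral_slices: "(\<integral>x. \<integral>t. f (x(Suc n := t)) \<partial>lborel \<partial>lebesgue_Rn n) = (\<integral>x. f x \<partial>lebesgue_Rn (Suc n))"
proof -
  interpret pair_sigma_finite "lebesgue_Rn n" "lborel :: real measure"
    by (rule pair_sigma_finite_lebesgue_Rn_lborel)
  have meas: "f \<in> borel_measurable (lebesgue_Rn (Suc n))" using assms by simp
  have "integrable (distr (lebesgue_Rn n \<Otimes>\<^sub>M lborel) (lebesgue_Rn (Suc n)) (\<lambda>(x, t). x(Suc n := t))) f"
    by (subst lebesgue_Rn_Suc_eq_distr[symmetric]) (rule assms)
  then have int: "integrable (lebesgue_Rn n \<Otimes>\<^sub>M lborel) (\<lambda>p. f ((\<lambda>(x, t). x(Suc n := t)) p))"
    by (rule integrable_distr[OF measurable_append])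
  have eq: "(\<integral>p. f ((\<lambda>(x, t). x(Suc n := t)) p) \<partial>(lebesgue_Rn n \<Otimes>\<^sub>M lborel)) = (\<integral>x. f x \<partial>lebesgue_Rn (Suc n))"
    using integral_distr[OF measurable_append meas] by (simp only: lebesgue_Rn_Suc_eq_distr[symmetric])
  show "AE x in lebesgue_Rn n. integrable lborel (\<lambda>t. f (x(Suc n := t)))"
    using AE_integrable_fst'[OF int] by simp
  show "integrable (lebesgue_Rn n) (\<lambda>x. \<integral>t. f (x(Suc n := t)) \<partial>lborel)"
    using integrable_fst'[OF int] by simp
  show "(\<integral>x. \<integral>t. f (x(Suc n := t)) \<partial>lborel \<partial>lebesgue_Rn n) = (\<integral>x. f x \<partial>lebesgue_Rn (Suc n))"
    using integral_fst'[OF int] eq by simp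
qed

lemma append_in_cube_iff:
  assumes "x \<in> Rn n"
  shows "x(Suc n := t) \<in> cube (Suc n) r \<longleftrightarrow> x \<in> cube n r \<and> \<bar>t\<bar> \<le> r"
proof -
  have "x(Suc n := t) \<in> extensional {1..Suc n}"
    using assms by (auto simp: Rn_def PiE_iff extensional_def)
  moreover have "(\<forall>i\<in>{1..Suc n}. (x(Suc n := t)) i \<in> {-r..r}) \<longleftrightarrow> (\<forall>i\<in>{1..n}. x i \<in> {-r..r}) \<and> \<bar>t\<bar> \<le> r"
    by (auto simp: atLeastAtMostSuc_conv abs_le_iff)
  ultimately show ?thesis
    using assms by (auto simp: cube_def PiE_iff Rn_def)
qed

text \<open>
Integrability over the countably many cubes of integer size gives one null set outside of which the slice is
integrable over every bounded interval.
\<close>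

lemma AE_locally_integrable_slice:
  assumes w: "locally_integrable (Suc n) w"
  shows "AE x in lebesgue_Rn n. locally_integrable_real (\<lambda>t. w (x(Suc n := t)))"
proof -
  have "AE x in lebesgue_Rn n. \<forall>k::nat. integrable lborel
      (\<lambda>t. indicator (cube (Suc n) (real k)) (x(Suc n := t)) * w (x(Suc n := t)))"
    unfolding AE_all_countable
  proof
    fix k :: nat
    show "AE x in lebesgue_Rn n. integrable lborel
        (\<lambda>t. indicator (cube (Suc n) (real k)) (x(Suc n := t)) * w (x(Suc n := t)))"
      by (rule AE_integrable_slice) (use w in \<open>simp add: locally_integrable_def set_integrable_def\<close>)
  qed
  with AE_space show ?thesis
  proof eventually_elim
    fix x assume "x \<in> space (lebesgue_Rn n)" and int: "\<forall>k::nat. integrable lborel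
      (\<lambda>t. indicator (cube (Suc n) (real k)) (x(Suc n := t)) * w (x(Suc n := t)))"
    then have x: "x \<in> Rn n" by simp
    show "locally_integrable_real (\<lambda>t. w (x(Suc n := t)))"
      unfolding locally_integrable_real_def
    proof
      fix r :: real
      obtain k1 where k1: "\<And>k. k \<ge> k1 \<Longrightarrow> x \<in> cube n (real k)"
        using in_cube_eventually[OF x] by (auto simp: eventually_sequentially)
      define k where "k = max k1 (nat \<lceil>\<bar>r\<bar>\<rceil>)"
      have "real (nat \<lceil>\<bar>r\<bar>\<rceil>) \<le> real k" by (rule of_nat_mono) (simp add: k_def)
      then have "r \<le> real k" using real_nat_ceiling_ge[of "\<bar>r\<bar>"] by linarith
      moreover have "x \<in> cube n (real k)" by (rule k1) (simp add: k_def)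
      ultimately have k: "x \<in> cube n (real k)" "r \<le> real k" by blast+
      have eq: "(\<lambda>t. indicator (cube (Suc n) (real k)) (x(Suc n := t)) * w (x(Suc n := t)))
          = (\<lambda>t. indicator {-real k..real k} t * w (x(Suc n := t)))"
        by (rule ext) (use k in \<open>simp add: indicator_def append_in_cube_iff[OF x] abs_le_iff minus_le_iff conj_commute\<close>)
      have "set_integrable lborel {-real k..real k} (\<lambda>t. w (x(Suc n := t)))"
        using int[rule_format, of k] unfolding set_integrable_def real_scaleR_def by (simp only: eq)
      then show "set_integrable lborel {-r..r} (\<lambda>t. w (x(Suc n := t)))"
        by (rule set_integrable_subset) (use k in auto)
    qed
  qed
qed

lemma tensor_append:
  "tensor (Suc n) (\<psi>(Suc n := f)) (x(Suc n := t)) = f t * tensor n \<psi> x"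
proof -
  have "{1..Suc n} - {Suc n} = {1..n}" by auto
  then show ?thesis by (subst tensor_upd) (auto simp: tensor_def)
qed

lemma restrict_Rn: "x \<in> Rn n \<Longrightarrow> restrict x {1..n} = x"
  unfolding Rn_def by (rule PiE_restrict)

lemma restrict_append: "x \<in> Rn n \<Longrightarrow> restrict (x(Suc n := t)) {1..n} = x"
  by (rule ext) (auto simp: Rn_def PiE_iff extensional_def restrict_def)

text \<open>
As a function of the remaining variables, the defect in the weak equation of the slices is locally integrable.
Its integral against a product of bumps is the defect of the weak equation in all variables for one more
factor, which vanishes.
\<close>

lemma AE_slice_weak_derivative:
  assumes weak: "has_weak_pd (Suc n) (Suc n) v g" and \<phi>: "bump_on r \<phi>"
  shows "AE x in lebesgue_Rn n. (\<integral>t. v (x(Suc n := t)) * deriv \<phi> t + g (x(Suc n := t)) * \<phi> t \<partial>lborel) = 0"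
proof -
  let ?N = "Suc n"
  have loc: "locally_integrable ?N v" "locally_integrable ?N g"
    and parts: "\<And>\<phi>. test_function ?N \<phi> \<Longrightarrow>
        (\<integral>x. v x * pd ?N \<phi> x \<partial>lebesgue_Rn ?N) = - (\<integral>x. g x * \<phi> x \<partial>lebesgue_Rn ?N)"
    using weak by (auto simp: has_weak_pd_def)
  have [measurable]: "v \<in> borel_measurable (lebesgue_Rn ?N)" "g \<in> borel_measurable (lebesgue_Rn ?N)"
    using loc by (auto intro: locally_integrable_measurable)
  have \<phi>': "bump_on r (deriv \<phi>)" by (rule bump_on_deriv[OF \<phi>])
  have smooth: "smooth_fun \<phi>" using \<phi> by (simp add: bump_on_def)
  have [measurable]: "\<phi> \<in> borel_measurable borel" "deriv \<phi> \<in> borel_measurable borel"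
    using smooth by (auto intro: smooth_fun_measurable smooth_fun_deriv)
  obtain B1 where B1: "B1 \<ge> 0" "\<And>t. \<bar>\<phi> t\<bar> \<le> B1 * indicator {-r..r} t"
    using bump_on_bounded[OF \<phi>] by blast
  obtain B2 where B2: "B2 \<ge> 0" "\<And>t. \<bar>deriv \<phi> t\<bar> \<le> B2 * indicator {-r..r} t"
    using bump_on_bounded[OF \<phi>'] by blast
  have [measurable]: "(\<lambda>y. y ?N) \<in> borel_measurable (lebesgue_Rn ?N)"
    by (rule measurable_component_Rn) simp
  define f where "f y = v y * deriv \<phi> (y ?N) + g y * \<phi> (y ?N)" for y
  have [measurable]: "f \<in> borel_measurable (lebesgue_Rn ?N)" unfolding f_def[abs_def] by measurable
  define W where "W x = (\<integral>t. f (x(?N := t)) \<partial>lborel)" for x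
  have W: "locally_integrable n W"
    unfolding locally_integrable_def
  proof
    fix s
    \<comment> \<open>The support of the test function in the last coordinate turns the cylinder over the cube into a larger cube.\<close>
    define R where "R = max r s"
    let ?h = "\<lambda>y. indicator (cube n s) (restrict y {1..n}) * f y"
    have "integrable (lebesgue_Rn ?N) ?h"
    proof (rule Bochner_Integration.integrable_bound)
      show "integrable (lebesgue_Rn ?N) (\<lambda>y. B2 * \<bar>indicator (cube ?N R) y * v y\<bar> + B1 * \<bar>indicator (cube ?N R) y * g y\<bar>)"
        using loc by (intro Bochner_Integration.integrable_add integrable_mult_right integrable_abs)
          (auto simp: locally_integrable_def set_integrable_def)
      have [measurable]: "(\<lambda>y. restrict y {1..n}) \<in> measurable (lebesgue_Rn ?N) (lebesgue_Rn n)"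
        by (rule measurable_restrict_Rn) simp
      show "?h \<in> borel_measurable (lebesgue_Rn ?N)" by measurable
      show "AE y in lebesgue_Rn ?N. norm (?h y) \<le> norm (B2 * \<bar>indicator (cube ?N R) y * v y\<bar> + B1 * \<bar>indicator (cube ?N R) y * g y\<bar>)"
      proof (rule AE_I2)
        fix y assume "y \<in> space (lebesgue_Rn ?N)"
        then have y: "y \<in> Rn ?N" by simp
        define x where "x = restrict y {1..n}"
        have x: "x \<in> Rn n" by (auto simp: x_def Rn_def)
        have yx: "y = x(?N := y ?N)"
          using y by (auto simp: x_def Rn_def PiE_iff extensional_def fun_eq_iff restrict_def)
        show "norm (?h y) \<le> norm (B2 * \<bar>indicator (cube ?N R) y * v y\<bar> + B1 * \<bar>indicator (cube ?N R) y * g y\<bar>)"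
        proof (cases "x \<in> cube n s \<and> \<bar>y ?N\<bar> \<le> r")
          case True
          then have "x \<in> cube n R" "\<bar>y ?N\<bar> \<le> R" using cube_mono[of s R n] by (auto simp: R_def)
          then have yR: "y \<in> cube ?N R" using append_in_cube_iff[OF x, of "y ?N" R] yx by simp
          have "\<bar>f y\<bar> \<le> \<bar>v y * deriv \<phi> (y ?N)\<bar> + \<bar>g y * \<phi> (y ?N)\<bar>"
            unfolding f_def by (rule abs_triangle_ineq)
          also have "\<dots> = \<bar>deriv \<phi> (y ?N)\<bar> * \<bar>v y\<bar> + \<bar>\<phi> (y ?N)\<bar> * \<bar>g y\<bar>" by (simp add: abs_mult mult.commute)
          also have "\<dots> \<le> B2 * \<bar>v y\<bar> + B1 * \<bar>g y\<bar>"
            using B1(2)[of "y ?N"] B2(2)[of "y ?N"] True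
            by (intro add_mono mult_right_mono) (auto simp: indicator_def abs_le_iff split: if_splits)
          finally show ?thesis using yR True B1(1) B2(1) by (simp add: x_def)
        next
          case False
          have h0: "?h y = 0"
          proof (cases "x \<in> cube n s")
            case True
            then have "\<not> \<bar>y ?N\<bar> \<le> r" using False by simp
            then have "\<phi> (y ?N) = 0" "deriv \<phi> (y ?N) = 0" using \<phi> \<phi>' by (auto simp: bump_on_def)
            then show ?thesis by (simp add: f_def)
          qed (simp add: x_def)
          show ?thesis by (subst h0) (use B1(1) B2(1) in simp)
        qed
      qed
    qed
    from integrable_slice_integral[OF this]
    have "integrable (lebesgue_Rn n) (\<lambda>x. indicator (cube n s) x * W x)"
      by (rule Bochner_Integration.integrable_cong[THEN iffD1, rotated 2]) (simp_all add: restrict_append restrict_Rn W_def del: One_nat_def)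
    then show "set_integrable (lebesgue_Rn n) (cube n s) W" by (simp add: set_integrable_def)
  qed
  have "AE x in lebesgue_Rn n. W x = 0"
  proof (rule AE_zero_if_orthogonal_to_bumps[OF W])
    fix \<psi> :: "nat \<Rightarrow> real \<Rightarrow> real" and r' assume \<psi>: "\<And>j. bump_on r' (\<psi> j)"
    define R where "R = max r r'"
    define \<psi>0 where "\<psi>0 = \<psi>(?N := \<phi>)"
    define \<psi>1 where "\<psi>1 = \<psi>(?N := deriv \<phi>)"
    have on: "bump_on R (\<psi>0 j)" "bump_on R (\<psi>1 j)" for j
      using bump_on_mono[OF \<psi>, of R] bump_on_mono[OF \<phi>, of R] bump_on_mono[OF \<phi>', of R]
      by (auto simp: \<psi>0_def \<psi>1_def R_def)
    have int: "integrable (lebesgue_Rn ?N) (\<lambda>y. v y * tensor ?N \<psi>1 y)" "integrable (lebesgue_Rn ?N) (\<lambda>y. g y * tensor ?N \<psi>0 y)"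
      by (intro integrable_mult_tensor[where r = R] loc on)+
    have pd: "pd ?N (tensor ?N \<psi>0) = tensor ?N \<psi>1"
      using pd_tensor[of ?N ?N \<psi>0] smooth by (simp add: \<psi>0_def \<psi>1_def)
    have "(\<integral>x. W x * tensor n \<psi> x \<partial>lebesgue_Rn n)
        = (\<integral>x. \<integral>t. v (x(?N := t)) * tensor ?N \<psi>1 (x(?N := t)) + g (x(?N := t)) * tensor ?N \<psi>0 (x(?N := t)) \<partial>lborel \<partial>lebesgue_Rn n)"
      unfolding \<psi>0_def \<psi>1_def tensor_append W_def f_def
      by (intro Bochner_Integration.integral_cong refl) (subst integral_mult_left_zero[symmetric], simp add: algebra_simps)
    also have "\<dots> = (\<integral>y. v y * tensor ?N \<psi>1 y + g y * tensor ?N \<psi>0 y \<partial>lebesgue_Rn ?N)"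
      using int by (intro integral_slices Bochner_Integration.integrable_add)
    also have "\<dots> = 0"
      using int parts[OF test_function_tensor[of R \<psi>0 ?N]] on by (simp add: pd)
    finally show "(\<integral>x. W x * tensor n \<psi> x \<partial>lebesgue_Rn n) = 0" .
  qed
  then show ?thesis by (simp add: W_def f_def)
qed

text \<open>
Each test function excludes its own null set of slices; the countable test family keeps the union null.
\<close>

lemma AE_slice_eq_primitive:
  assumes weak: "has_weak_pd (Suc n) (Suc n) v g"
  shows "AE x in lebesgue_Rn n. locally_integrable_real (\<lambda>t. g (x(Suc n := t))) \<and>
    (\<exists>m. AE t in lborel. v (x(Suc n := t)) = m + primitive (\<lambda>s. g (x(Suc n := s))) t)"
proof -
  obtain \<Phi> :: "(real \<Rightarrow> real) set" where \<Phi>: "countable \<Phi>" "\<And>\<phi>. \<phi> \<in> \<Phi> \<Longrightarrow> \<exists>r. bump_on r \<phi>"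
    "\<And>a b k. a \<in> \<rat> \<Longrightarrow> b \<in> \<rat> \<Longrightarrow>
       \<exists>\<phi>\<in>\<Phi>. \<forall>t. deriv \<phi> t = bump k a b t - (\<integral>s. bump k a b s \<partial>lborel) * unit_bump t"
    using countable_test_family by blast
  have "AE x in lebesgue_Rn n. \<forall>\<phi>\<in>\<Phi>.
      (\<integral>t. v (x(Suc n := t)) * deriv \<phi> t + g (x(Suc n := t)) * \<phi> t \<partial>lborel) = 0"
    using \<Phi>(2) AE_slice_weak_derivative[OF weak]
    by (subst AE_ball_countable[OF \<Phi>(1)]) blast
  moreover have "AE x in lebesgue_Rn n. locally_integrable_real (\<lambda>t. v (x(Suc n := t)))"
    "AE x in lebesgue_Rn n. locally_integrable_real (\<lambda>t. g (x(Suc n := t)))"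
    using weak by (auto intro!: AE_locally_integrable_slice simp: has_weak_pd_def)
  ultimately show ?thesis
  proof eventually_elim
    case (elim x)
    then show ?case
      using AE_eq_primitive_if_weak_derivative[of "\<lambda>t. v (x(Suc n := t))" "\<lambda>t. g (x(Suc n := t))" \<Phi>, OF _ _ _ \<Phi>(2,3)]
      by blast
  qed
qed

section \<open>Change of variables for triangular maps\<close>

text \<open>
A lower-triangular map is constrained on \<open>\<real>\<^sup>d\<close> only; there it agrees with this one.
\<close>

definition triangular :: "nat \<Rightarrow> (nat \<Rightarrow> (nat \<Rightarrow> real) \<Rightarrow> real) \<Rightarrow> (nat \<Rightarrow> real) \<Rightarrow> nat \<Rightarrow> real" where
  "triangular d Ti x = (\<lambda>i\<in>{1..d}. Ti i (restrict x {1..i}))"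

lemma measurable_triangular:
  assumes "\<And>i. i \<in> {1..d} \<Longrightarrow> Ti i \<in> borel_measurable (lebesgue_Rn i)"
  shows "triangular d Ti \<in> measurable (lebesgue_Rn d) (lebesgue_Rn d)"
  unfolding triangular_def[abs_def] lebesgue_Rn_def[of d]
proof (rule measurable_restrict)
  fix i assume "i \<in> {1..d}"
  then show "(\<lambda>x. Ti i (restrict x {1..i})) \<in> measurable (Pi\<^sub>M {1..d} (\<lambda>_. lborel)) lborel"
    using measurable_compose[OF measurable_restrict_Rn assms, of i d] by (simp add: lebesgue_Rn_def)
qed

lemma restrict_append_le: "i \<le> n \<Longrightarrow> restrict (x(Suc n := t)) {1..i} = restrict x {1..i}"
  by (rule ext) (auto simp: restrict_def)

lemma restrict_append_top: "x \<in> Rn n \<Longrightarrow> restrict (x(Suc n := t)) {1..Suc n} = x(Suc n := t)"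
  by (rule ext) (auto simp: Rn_def PiE_iff extensional_def restrict_def)

lemma triangular_append:
  assumes "x \<in> Rn n"
  shows "triangular (Suc n) Ti (x(Suc n := t)) = (triangular n Ti x)(Suc n := Ti (Suc n) (x(Suc n := t)))"
proof
  fix i
  consider "i = Suc n" | "i \<in> {1..n}" | "i \<notin> {1..Suc n}" by fastforce
  then show "triangular (Suc n) Ti (x(Suc n := t)) i = ((triangular n Ti x)(Suc n := Ti (Suc n) (x(Suc n := t)))) i"
    by cases (auto simp: triangular_def restrict_append_top[OF assms] restrict_append_le simp del: One_nat_def)
qed

text \<open>
The factors of the Jacobian determinant are multiplied as extended nonnegative reals, so their signs on null
sets do not matter. In the induction step the last coordinate is integrated first: the other factors and the
other components are constant in it, and the integral over it is a substitution on the line.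
\<close>

theorem nn_integral_triangular_substitution:
  assumes weak: "\<And>i. i \<in> {1..d} \<Longrightarrow> has_weak_pd i i (Ti i) (g i)"
    and c: "c > 0" "\<And>i. i \<in> {1..d} \<Longrightarrow> AE y in lebesgue_Rn i. g i y > c"
    and f: "f \<in> borel_measurable (lebesgue_Rn d)"
  shows "(\<integral>\<^sup>+x. f (triangular d Ti x) * (\<Prod>i\<in>{1..d}. ennreal (g i (restrict x {1..i}))) \<partial>lebesgue_Rn d)
    = (\<integral>\<^sup>+y. f y \<partial>lebesgue_Rn d)"
  using weak c(2) f
proof (induction d arbitrary: f)
  case 0
  have "triangular 0 Ti x = x" if "x \<in> Rn 0" for x
    using that by (auto simp: triangular_def Rn_def)
  then show ?case by (intro nn_integral_cong) simp
next
  case (Suc n)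
  let ?N = "Suc n"
  note [measurable] = Suc.prems(3)
  have meas: "Ti i \<in> borel_measurable (lebesgue_Rn i)" "g i \<in> borel_measurable (lebesgue_Rn i)" if "i \<in> {1..?N}" for i
    using Suc.prems(1)[OF that] by (auto simp: has_weak_pd_def intro: locally_integrable_measurable)
  define J where "J m x = (\<Prod>i\<in>{1..m}. ennreal (g i (restrict x {1..i})))" for m x
  have J_meas: "J m \<in> borel_measurable (lebesgue_Rn m)" if "m \<le> ?N" for m
    unfolding J_def
  proof (rule borel_measurable_prod_ennreal)
    fix i assume "i \<in> {1..m}"
    then show "(\<lambda>x. ennreal (g i (restrict x {1..i}))) \<in> borel_measurable (lebesgue_Rn m)"
      using measurable_compose[OF measurable_restrict_Rn meas(2), of i m] that by simp
  qed
  have J_append: "J ?N (x(?N := t)) = J n x * ennreal (g ?N (x(?N := t)))" if "x \<in> Rn n" for x t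
  proof -
    have "J ?N (x(?N := t)) = (\<Prod>i\<in>{1..n}. ennreal (g i (restrict (x(?N := t)) {1..i}))) * ennreal (g ?N (restrict (x(?N := t)) {1..?N}))"
      by (simp add: J_def)
    also have "(\<Prod>i\<in>{1..n}. ennreal (g i (restrict (x(?N := t)) {1..i}))) = J n x"
      unfolding J_def by (intro prod.cong refl) (simp add: restrict_append_le)
    finally show ?thesis by (simp only: restrict_append_top[OF that])
  qed
  have tri: "triangular m Ti \<in> measurable (lebesgue_Rn m) (lebesgue_Rn m)" if "m \<le> ?N" for m
    using that by (intro measurable_triangular meas) auto
  have tri_Rn: "triangular n Ti x \<in> Rn n" for x by (auto simp: triangular_def Rn_def)
  define f' where "f' z = (\<integral>\<^sup>+y. f (z(?N := y)) \<partial>lborel)" for z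
  have f': "f' \<in> borel_measurable (lebesgue_Rn n)"
  proof -
    have "(\<lambda>p. f ((\<lambda>(x, t). x(?N := t)) p)) \<in> borel_measurable (lebesgue_Rn n \<Otimes>\<^sub>M lborel)"
      by (rule measurable_compose[OF measurable_append]) measurable
    from lborel.borel_measurable_nn_integral_fst[OF this] show ?thesis by (simp add: f'_def[abs_def])
  qed
  have "AE x in lebesgue_Rn n. AE t in lborel. g ?N (x(?N := t)) > c"
    by (rule AE_slice[OF Suc.prems(2)]) simp
  moreover have "AE x in lebesgue_Rn n. locally_integrable_real (\<lambda>t. g ?N (x(?N := t))) \<and>
      (\<exists>m. AE t in lborel. Ti ?N (x(?N := t)) = m + primitive (\<lambda>s. g ?N (x(?N := s))) t)"
    by (rule AE_slice_eq_primitive[OF Suc.prems(1)]) simp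
  ultimately have inner: "AE x in lebesgue_Rn n.
      (\<integral>\<^sup>+t. f (triangular ?N Ti (x(?N := t))) * J ?N (x(?N := t)) \<partial>lborel) = f' (triangular n Ti x) * J n x"
    using AE_space
  proof eventually_elim
    fix x assume gc: "AE t in lborel. c < g ?N (x(?N := t))"
      and AC: "locally_integrable_real (\<lambda>t. g ?N (x(?N := t))) \<and>
        (\<exists>m. AE t in lborel. Ti ?N (x(?N := t)) = m + primitive (\<lambda>s. g ?N (x(?N := s))) t)"
      and "x \<in> space (lebesgue_Rn n)"
    then have x: "x \<in> Rn n" by simp
    from AC obtain m where m: "AE t in lborel. Ti ?N (x(?N := t)) = m + primitive (\<lambda>s. g ?N (x(?N := s))) t"
      by blast
    have [measurable]: "(\<lambda>t. f ((triangular n Ti x)(?N := t))) \<in> borel_measurable borel"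
      by (rule measurable_append_section[OF Suc.prems(3) tri_Rn])
    have [measurable]: "(\<lambda>t. g ?N (x(?N := t))) \<in> borel_measurable borel"
      using AC by (auto intro: locally_integrable_real_measurable)
    have prim [measurable]: "primitive (\<lambda>s. g ?N (x(?N := s))) \<in> borel_measurable borel"
      using AC by (intro borel_measurable_continuous_onI continuous_primitive) auto
    let ?f = "\<lambda>t. f ((triangular n Ti x)(?N := t))"
    let ?g = "\<lambda>t. g ?N (x(?N := t))"
    have "(\<integral>\<^sup>+t. f (triangular ?N Ti (x(?N := t))) * J ?N (x(?N := t)) \<partial>lborel)
        = (\<integral>\<^sup>+t. J n x * (?f (m + primitive ?g t) * ennreal (?g t)) \<partial>lborel)"
      using m by (intro nn_integral_cong_AE) (auto elim!: eventually_mono simp: triangular_append[OF x] J_append[OF x] mult_ac)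
    also have "\<dots> = J n x * (\<integral>\<^sup>+t. ?f (m + primitive ?g t) * ennreal (?g t) \<partial>lborel)"
      by (rule nn_integral_cmult) (auto intro!: borel_measurable_times_ennreal measurable_compose[where f = "\<lambda>t. m + primitive ?g t" and g = ?f])
    also have "(\<integral>\<^sup>+t. ?f (m + primitive ?g t) * ennreal (?g t) \<partial>lborel) = f' (triangular n Ti x)"
      unfolding f'_def using AC gc c(1) by (intro nn_integral_substitution_primitive) auto
    also have "J n x * f' (triangular n Ti x) = f' (triangular n Ti x) * J n x" by (rule mult.commute)
    finally show "(\<integral>\<^sup>+t. f (triangular ?N Ti (x(?N := t))) * J ?N (x(?N := t)) \<partial>lborel) = f' (triangular n Ti x) * J n x" .
  qed
  have "(\<integral>\<^sup>+x. f (triangular ?N Ti x) * J ?N x \<partial>lebesgue_Rn ?N)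
      = (\<integral>\<^sup>+x. \<integral>\<^sup>+t. f (triangular ?N Ti (x(?N := t))) * J ?N (x(?N := t)) \<partial>lborel \<partial>lebesgue_Rn n)"
    by (rule nn_integral_lebesgue_Rn_Suc)
      (intro borel_measurable_times_ennreal J_meas measurable_compose[OF tri Suc.prems(3)] order_refl)
  also have "\<dots> = (\<integral>\<^sup>+x. f' (triangular n Ti x) * J n x \<partial>lebesgue_Rn n)"
    by (rule nn_integral_cong_AE[OF inner])
  also have "\<dots> = (\<integral>\<^sup>+z. f' z \<partial>lebesgue_Rn n)"
    unfolding J_def using Suc.prems(1,2) f' by (intro Suc.IH) auto
  also have "\<dots> = (\<integral>\<^sup>+y. f y \<partial>lebesgue_Rn ?N)"
    unfolding f'_def by (rule nn_integral_lebesgue_Rn_Suc[symmetric]) measurable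
  finally show ?case by (simp only: J_def)
qed

section \<open>Uniqueness and linearity of weak derivatives\<close>

lemma has_weak_pd_unique:
  assumes "has_weak_pd n k v g" "has_weak_pd n k v h"
  shows "AE x in lebesgue_Rn n. g x = h x"
proof -
  have loc: "locally_integrable n g" "locally_integrable n h"
    using assms by (auto simp: has_weak_pd_def)
  have "AE x in lebesgue_Rn n. g x - h x = 0"
  proof (rule AE_zero_if_orthogonal_to_bumps)
    show "locally_integrable n (\<lambda>x. g x - h x)"
      using loc by (simp add: locally_integrable_def set_integral_diff)
    fix \<psi> :: "nat \<Rightarrow> real \<Rightarrow> real" and r assume \<psi>: "\<And>j. bump_on r (\<psi> j)"
    have "(\<integral>x. g x * tensor n \<psi> x \<partial>lebesgue_Rn n) = (\<integral>x. h x * tensor n \<psi> x \<partial>lebesgue_Rn n)"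
      using assms test_function_tensor[OF \<psi>] by (simp add: has_weak_pd_def)
    then show "(\<integral>x. (g x - h x) * tensor n \<psi> x \<partial>lebesgue_Rn n) = 0"
      using integrable_mult_tensor[OF loc(1) \<psi>] integrable_mult_tensor[OF loc(2) \<psi>]
      by (simp add: left_diff_distrib)
  qed
  then show ?thesis by simp
qed

text \<open>
The derivative sees a neighbourhood of its base point only. If the coordinate that leaves the cube is the one
being varied, it stays outside for nearby values; otherwise it does not move at all.
\<close>

lemma pd_zero_outside_cube:
  assumes k: "k \<in> {1..n}" and supp: "\<And>x. x \<in> Rn n - cube n r \<Longrightarrow> \<phi> x = 0"
    and x: "x \<in> Rn n - cube n r"
  shows "pd k \<phi> x = 0"
proof -
  obtain j where j: "j \<in> {1..n}" "x j \<notin> {-r..r}"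
    using x by (auto simp: Rn_def cube_def PiE_iff)
  define S where "S = (if j = k then - {-r..r} else UNIV :: real set)"
  have "((\<lambda>_. 0) has_real_derivative 0) (at (x k))" by simp
  then have "((\<lambda>t. \<phi> (x(k := t))) has_real_derivative 0) (at (x k))"
  proof (rule has_field_derivative_transform_within_open[of _ _ _ S])
    show "open S" by (auto simp: S_def closed_atLeastAtMost)
    show "x k \<in> S" using j by (auto simp: S_def)
    fix t assume t: "t \<in> S"
    have "x(k := t) \<in> Rn n" using x k by (auto simp: Rn_def PiE_iff extensional_def)
    moreover have "x(k := t) \<notin> cube n r"
    proof
      assume "x(k := t) \<in> cube n r"
      then have "(x(k := t)) j \<in> {-r..r}" using j(1) unfolding cube_def by (rule PiE_mem)
      then show False using t j(2) by (auto simp: S_def split: if_splits)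
    qed
    ultimately show "0 = \<phi> (x(k := t))" using supp by simp
  qed
  then show ?thesis by (simp add: pd_def DERIV_imp_deriv)
qed

text \<open>
Arbitrary test functions and their derivatives are bounded and vanish outside a cube, so all integrals
involved converge and may be split.
\<close>

lemma has_weak_pd_diff:
  assumes k: "k \<in> {1..n}" and v: "has_weak_pd n k v g" and w: "has_weak_pd n k w h"
  shows "has_weak_pd n k (\<lambda>x. v x - w x) (\<lambda>x. g x - h x)"
  unfolding has_weak_pd_def
proof (intro conjI allI impI)
  have loc: "locally_integrable n v" "locally_integrable n g" "locally_integrable n w" "locally_integrable n h"
    using v w by (auto simp: has_weak_pd_def)
  show "locally_integrable n (\<lambda>x. v x - w x)" "locally_integrable n (\<lambda>x. g x - h x)"
    using loc by (simp_all add: locally_integrable_def set_integral_diff)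
  fix \<phi> assume \<phi>: "test_function n \<phi>"
  then obtain r where supp: "\<And>x. x \<in> Rn n - cube n r \<Longrightarrow> \<phi> x = 0" by (auto simp: test_function_def)
  have smooth: "smooth_Rn n \<phi>" using \<phi> by (simp add: test_function_def)
  have cont: "continuous_map (powertop_real {1..n}) euclideanreal \<phi>"
    using smooth unfolding smooth_Rn_def by (auto dest: bspec[where x = "[]"])
  have cont': "continuous_map (powertop_real {1..n}) euclideanreal (pd k \<phi>)"
    using smooth k unfolding smooth_Rn_def by (auto dest: bspec[where x = "[k]"])
  have supp': "pd k \<phi> x = 0" if "x \<in> Rn n - cube n r" for x
    using k supp that by (rule pd_zero_outside_cube)
  have int: "integrable (lebesgue_Rn n) (\<lambda>x. f x * \<phi> x)" if "locally_integrable n f" for f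
    using that cont supp by (rule integrable_mult_compactly_supported)
  have int': "integrable (lebesgue_Rn n) (\<lambda>x. f x * pd k \<phi> x)" if "locally_integrable n f" for f
    using that cont' supp' by (rule integrable_mult_compactly_supported)
  have "(\<integral>x. (v x - w x) * pd k \<phi> x \<partial>lebesgue_Rn n)
      = (\<integral>x. v x * pd k \<phi> x \<partial>lebesgue_Rn n) - (\<integral>x. w x * pd k \<phi> x \<partial>lebesgue_Rn n)"
    using int'[OF loc(1)] int'[OF loc(3)] by (simp add: left_diff_distrib)
  also have "\<dots> = - (\<integral>x. g x * \<phi> x \<partial>lebesgue_Rn n) + (\<integral>x. h x * \<phi> x \<partial>lebesgue_Rn n)"
    using v w \<phi> by (simp add: has_weak_pd_def)
  also have "\<dots> = - (\<integral>x. (g x - h x) * \<phi> x \<partial>lebesgue_Rn n)"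
    using int[OF loc(2)] int[OF loc(4)] by (simp add: left_diff_distrib)
  finally show "(\<integral>x. (v x - w x) * pd k \<phi> x \<partial>lebesgue_Rn n) = - (\<integral>x. (g x - h x) * \<phi> x \<partial>lebesgue_Rn n)" .
qed

lemma has_weak_pd_weak_pd: "has_weak_pd n k v g \<Longrightarrow> has_weak_pd n k v (weak_pd n k v)"
  unfolding weak_pd_def by (rule someI[where P = "has_weak_pd n k v"])

text \<open>
The weak derivative is an arbitrary choice among versions, so linearity holds almost everywhere only.
\<close>

lemma AE_weak_pd_diff:
  assumes "k \<in> {1..n}" "has_weak_pd n k v g" "has_weak_pd n k w h"
  shows "AE x in lebesgue_Rn n. weak_pd n k (\<lambda>x. v x - w x) x = weak_pd n k v x - weak_pd n k w x"
proof -
  have diff: "has_weak_pd n k (\<lambda>x. v x - w x) (\<lambda>x. weak_pd n k v x - weak_pd n k w x)"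
    by (rule has_weak_pd_diff[OF assms(1) has_weak_pd_weak_pd[OF assms(2)] has_weak_pd_weak_pd[OF assms(3)]])
  show ?thesis by (rule has_weak_pd_unique[OF has_weak_pd_weak_pd[OF diff] diff])
qed

section \<open>Gaussian measures and densities of pullbacks\<close>

definition gauss_density :: "nat \<Rightarrow> (nat \<Rightarrow> real) \<Rightarrow> real" where
  "gauss_density d x = (\<Prod>i\<in>{1..d}. std_normal_density (x i))"

lemma gauss_density_pos: "gauss_density d x > 0"
  unfolding gauss_density_def by (intro prod_pos) (simp add: normal_density_pos)

lemma gauss_density_measurable [measurable]: "gauss_density d \<in> borel_measurable (lebesgue_Rn d)"
  unfolding gauss_density_def[abs_def]
  by (intro borel_measurable_prod measurable_compose[OF measurable_component_Rn]) auto

lemma prob_space_std_normal: "prob_space (density lborel (\<lambda>t. ennreal (std_normal_density t)))"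
  by (rule prob_space_normal_density) simp

interpretation gauss_family:
  product_prob_space "\<lambda>_. density lborel (\<lambda>t. ennreal (std_normal_density t))" "UNIV :: nat set"
  by (rule product_prob_spaceI) (rule prob_space_std_normal)

lemma sets_std_gaussian [measurable_cong, simp]: "sets (std_gaussian d) = sets (lebesgue_Rn d)"
  unfolding std_gaussian_def lebesgue_Rn_def by (intro sets_PiM_cong) simp_all

lemma space_std_gaussian [simp]: "space (std_gaussian d) = Rn d"
  using sets_eq_imp_space_eq[OF sets_std_gaussian] by simp

lemma prob_space_std_gaussian: "prob_space (std_gaussian d)"
  unfolding std_gaussian_def by (rule prob_space_PiM) (rule prob_space_std_normal)

lemma std_gaussian_eq_density:
  "std_gaussian d = density (lebesgue_Rn d) (\<lambda>x. ennreal (gauss_density d x))"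
  unfolding std_gaussian_def
proof (rule gauss_family.PiM_eqI[symmetric])
  show "sets (density (lebesgue_Rn d) (\<lambda>x. ennreal (gauss_density d x)))
      = sets (\<Pi>\<^sub>M i\<in>{1..d}. density lborel (\<lambda>t. ennreal (std_normal_density t)))"
    using sets_std_gaussian[of d] by (simp add: std_gaussian_def)
  fix A assume "\<And>i. i \<in> {1..d} \<Longrightarrow> A i \<in> sets (density lborel (\<lambda>t. ennreal (std_normal_density t)))"
  then have A: "\<And>i. i \<in> {1..d} \<Longrightarrow> A i \<in> sets lborel" by simp
  have "PiE {1..d} A \<in> sets (lebesgue_Rn d)"
    unfolding lebesgue_Rn_def using A by (intro sets_PiM_I_finite) auto
  then have "emeasure (density (lebesgue_Rn d) (\<lambda>x. ennreal (gauss_density d x))) (PiE {1..d} A)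
      = (\<integral>\<^sup>+x. ennreal (gauss_density d x) * indicator (PiE {1..d} A) x \<partial>lebesgue_Rn d)"
    by (intro emeasure_density) auto
  also have "\<dots> = (\<integral>\<^sup>+x. (\<Prod>i\<in>{1..d}. ennreal (std_normal_density (x i)) * indicator (A i) (x i)) \<partial>lebesgue_Rn d)"
  proof (rule nn_integral_cong)
    fix x assume "x \<in> space (lebesgue_Rn d)"
    then have "(\<Prod>i\<in>{1..d}. indicator (A i) (x i)) = (indicator (PiE {1..d} A) x :: ennreal)"
      by (auto simp: indicator_def Rn_def PiE_iff)
    then show "ennreal (gauss_density d x) * indicator (PiE {1..d} A) x
        = (\<Prod>i\<in>{1..d}. ennreal (std_normal_density (x i)) * indicator (A i) (x i))"
      by (simp add: gauss_density_def prod_ennreal prod.distrib)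
  qed
  also have "\<dots> = (\<Prod>i\<in>{1..d}. \<integral>\<^sup>+t. ennreal (std_normal_density t) * indicator (A i) t \<partial>lborel)"
    unfolding lebesgue_Rn_def using A by (intro lborel_family.product_nn_integral_prod) auto
  also have "\<dots> = (\<Prod>i\<in>{1..d}. emeasure (density lborel (\<lambda>t. ennreal (std_normal_density t))) (A i))"
    using A by (intro prod.cong) (simp_all add: emeasure_density)
  finally show "emeasure (density (lebesgue_Rn d) (\<lambda>x. ennreal (gauss_density d x))) (PiE {1..d} A)
      = (\<Prod>i\<in>{1..d}. emeasure (density lborel (\<lambda>t. ennreal (std_normal_density t))) (A i))" .
qed simp

text \<open>
The Gaussian density is positive, so Gaussian and Lebesgue null sets coincide.
\<close>

lemma AE_std_gaussian_iff: "(AE x in std_gaussian d. P x) \<longleftrightarrow> (AE x in lebesgue_Rn d. P x)"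
  unfolding std_gaussian_eq_density by (subst AE_density) (simp_all add: gauss_density_pos)

lemma measurable_std_gaussian [simp]: "borel_measurable (std_gaussian d) = borel_measurable (lebesgue_Rn d)"
  by (rule measurable_cong_sets) simp_all

text \<open>
The norms of the components may thus be computed with the standard Gaussian of the smaller dimension.
\<close>

lemma marginal_std_gaussian:
  assumes "i \<le> d"
  shows "marginal i (std_gaussian d) = std_gaussian i"
proof -
  have "marginal i (std_gaussian d) = distr (std_gaussian d) (std_gaussian i) (\<lambda>x. restrict x {1..i})"
    unfolding marginal_def by (rule distr_cong) simp_all
  also have "\<dots> = std_gaussian i"
    unfolding std_gaussian_def using assms by (intro gauss_family.distr_restrict[symmetric]) auto
  finally show ?thesis .
qed

lemma restrict_measurable_std_gaussian:
  "i \<le> d \<Longrightarrow> (\<lambda>x. restrict x {1..i}) \<in> measurable (std_gaussian d) (lebesgue_Rn i)"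
  using measurable_restrict_Rn[of i d] by (simp cong: measurable_cong_sets)

lemma
  fixes h :: "(nat \<Rightarrow> real) \<Rightarrow> real"
  assumes "i \<le> d" "h \<in> borel_measurable (lebesgue_Rn i)"
  shows integral_marginal: "(\<integral>x. h (restrict x {1..i}) \<partial>std_gaussian d) = (\<integral>y. h y \<partial>std_gaussian i)"
    and integrable_marginal: "integrable (std_gaussian d) (\<lambda>x. h (restrict x {1..i})) \<longleftrightarrow> integrable (std_gaussian i) h"
  using integral_distr[OF restrict_measurable_std_gaussian assms(2), of d]
    integrable_distr_eq[OF restrict_measurable_std_gaussian assms(2), of d] assms(1)
    marginal_std_gaussian[of i d]
  by (simp_all add: marginal_def)

lemma AE_marginal_iff:
  assumes "i \<le> d" "{y \<in> Rn i. P y} \<in> sets (lebesgue_Rn i)"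
  shows "(AE x in std_gaussian d. P (restrict x {1..i})) \<longleftrightarrow> (AE y in lebesgue_Rn i. P y)"
proof -
  have "(AE y in marginal i (std_gaussian d). P y) \<longleftrightarrow> (AE x in std_gaussian d. P (restrict x {1..i}))"
    unfolding marginal_def by (rule AE_distr_iff[OF restrict_measurable_std_gaussian]) (use assms in auto)
  then show ?thesis unfolding marginal_std_gaussian[OF assms(1)] AE_std_gaussian_iff[where d = i] by (rule sym)
qed

lemma AE_all_marginals_greater:
  fixes r :: "nat \<Rightarrow> (nat \<Rightarrow> real) \<Rightarrow> real"
  assumes "\<And>i. i \<in> {1..d} \<Longrightarrow> r i \<in> borel_measurable (lebesgue_Rn i)"
    and "\<And>i. i \<in> {1..d} \<Longrightarrow> AE y in lebesgue_Rn i. r i y > c"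
  shows "AE x in lebesgue_Rn d. \<forall>i\<in>{1..d}. r i (restrict x {1..i}) > c"
proof (subst AE_ball_countable)
  show "\<forall>i\<in>{1..d}. AE x in lebesgue_Rn d. r i (restrict x {1..i}) > c"
  proof
    fix i assume i: "i \<in> {1..d}"
    have [measurable]: "r i \<in> borel_measurable (lebesgue_Rn i)" by (rule assms(1)[OF i])
    have "{y \<in> space (lebesgue_Rn i). r i y > c} \<in> sets (lebesgue_Rn i)" by measurable
    then have "AE x in std_gaussian d. r i (restrict x {1..i}) > c"
      using i assms(2)[OF i] by (subst AE_marginal_iff[of i d "\<lambda>y. r i y > c"]) simp_all
    then show "AE x in lebesgue_Rn d. r i (restrict x {1..i}) > c"
      by (rule AE_std_gaussian_iff[THEN iffD1])
  qed
qed simp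

text \<open>
The triangular substitution is applied to the product of the Gaussian density and the indicator of \<open>A\<close>
composed with the inverse map; the inverse cancels against \<open>F\<close> under the integral.
\<close>

lemma pullback_std_gaussian:
  assumes tri: "lower_triangular d F Fi" and inv: "invertible_map d F"
    and weak: "\<And>i. i \<in> {1..d} \<Longrightarrow> has_weak_pd i i (Fi i) (g i)"
    and c: "c > 0" "\<And>i. i \<in> {1..d} \<Longrightarrow> AE y in lebesgue_Rn i. g i y > c"
  shows "pullback d F (std_gaussian d)
    = density (lebesgue_Rn d) (\<lambda>x. ennreal (gauss_density d (F x) * (\<Prod>i\<in>{1..d}. g i (restrict x {1..i}))))"
proof -
  let ?M = "lebesgue_Rn d" and ?inv = "the_inv_into (Rn d) F"
  let ?J = "\<lambda>x. \<Prod>i\<in>{1..d}. ennreal (g i (restrict x {1..i}))"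
  have [measurable]: "?inv \<in> measurable ?M ?M" "F \<in> measurable ?M ?M"
    and bij: "bij_betw F (Rn d) (Rn d)"
    using inv by (auto simp: invertible_map_def)
  have inv_F: "?inv (F x) = x" if "x \<in> Rn d" for x
    using bij that by (intro the_inv_into_f_f) (auto simp: bij_betw_def)
  have F_tri: "F x = triangular d Fi x" if "x \<in> Rn d" for x
    using tri that by (simp add: lower_triangular_def triangular_def)
  have g_meas: "g i \<in> borel_measurable (lebesgue_Rn i)" if "i \<in> {1..d}" for i
    using weak[OF that] by (auto simp: has_weak_pd_def intro: locally_integrable_measurable)
  have J_meas [measurable]: "?J \<in> borel_measurable ?M"
  proof (rule borel_measurable_prod_ennreal)
    fix i assume "i \<in> {1..d}"
    then show "(\<lambda>x. ennreal (g i (restrict x {1..i}))) \<in> borel_measurable ?M"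
      using measurable_compose[OF measurable_restrict_Rn g_meas, of i d] by simp
  qed
  have g_pos: "AE x in ?M. \<forall>i\<in>{1..d}. g i (restrict x {1..i}) > c"
    by (rule AE_all_marginals_greater[OF g_meas c(2)])
  have "pullback d F (std_gaussian d) = density ?M (\<lambda>x. ennreal (gauss_density d (F x)) * ?J x)"
  proof (rule measure_eqI)
    fix A assume "A \<in> sets (pullback d F (std_gaussian d))"
    then have [measurable]: "A \<in> sets ?M" by (simp add: pullback_def)
    let ?f = "\<lambda>y. ennreal (gauss_density d y) * indicator A (?inv y)"
    have "emeasure (pullback d F (std_gaussian d)) A = (\<integral>\<^sup>+x. indicator A x \<partial>pullback d F (std_gaussian d))"
      by (rule nn_integral_indicator[symmetric]) (simp add: pullback_def)
    also have "\<dots> = (\<integral>\<^sup>+y. indicator A (?inv y) \<partial>std_gaussian d)"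
      unfolding pullback_def by (rule nn_integral_distr) measurable
    also have "\<dots> = (\<integral>\<^sup>+y. ?f y \<partial>?M)"
      unfolding std_gaussian_eq_density by (rule nn_integral_density) measurable
    also have "\<dots> = (\<integral>\<^sup>+x. ?f (triangular d Fi x) * ?J x \<partial>?M)"
      using weak c by (intro nn_integral_triangular_substitution[symmetric]) measurable
    also have "\<dots> = (\<integral>\<^sup>+x. ennreal (gauss_density d (F x)) * ?J x * indicator A x \<partial>?M)"
      by (intro nn_integral_cong) (simp add: F_tri[symmetric] inv_F mult_ac)
    also have "\<dots> = emeasure (density ?M (\<lambda>x. ennreal (gauss_density d (F x)) * ?J x)) A"
      by (rule emeasure_density[symmetric]) measurable
    finally show "emeasure (pullback d F (std_gaussian d)) A
        = emeasure (density ?M (\<lambda>x. ennreal (gauss_density d (F x)) * ?J x)) A" .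
  qed (simp add: pullback_def)
  also have "\<dots> = density ?M (\<lambda>x. ennreal (gauss_density d (F x) * (\<Prod>i\<in>{1..d}. g i (restrict x {1..i}))))"
  proof (rule density_cong)
    show ae: "AE x in ?M. ennreal (gauss_density d (F x)) * ?J x
        = ennreal (gauss_density d (F x) * (\<Prod>i\<in>{1..d}. g i (restrict x {1..i})))"
      using g_pos
    proof eventually_elim
      fix x assume gc: "\<forall>i\<in>{1..d}. g i (restrict x {1..i}) > c"
      then have pos: "0 \<le> g i (restrict x {1..i})" if "i \<in> {1..d}" for i
        using bspec[OF gc that] c(1) by linarith
      have "?J x = ennreal (\<Prod>i\<in>{1..d}. g i (restrict x {1..i}))"
        by (rule prod_ennreal) (rule pos)
      then show "ennreal (gauss_density d (F x)) * ?J x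
          = ennreal (gauss_density d (F x) * (\<Prod>i\<in>{1..d}. g i (restrict x {1..i})))"
        by (simp add: ennreal_mult' less_imp_le gauss_density_pos)
    qed
    have "(\<lambda>x. \<Prod>i\<in>{1..d}. g i (restrict x {1..i})) \<in> borel_measurable ?M"
    proof (rule borel_measurable_prod)
      fix i assume "i \<in> {1..d}"
      then show "(\<lambda>x. g i (restrict x {1..i})) \<in> borel_measurable ?M"
        using measurable_compose[OF measurable_restrict_Rn g_meas, of i d] by simp
    qed
    then show "(\<lambda>x. ennreal (gauss_density d (F x) * (\<Prod>i\<in>{1..d}. g i (restrict x {1..i})))) \<in> borel_measurable ?M"
      by measurable
  qed measurable
  finally show ?thesis .
qed

section \<open>The Kullback--Leibler estimate\<close>

lemma AE_leb_density:
  assumes "p \<in> borel_measurable (lebesgue_Rn d)" "AE x in lebesgue_Rn d. 0 \<le> p x"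
  shows "AE x in lebesgue_Rn d. leb_density d (density (lebesgue_Rn d) (\<lambda>x. ennreal (p x))) x = p x"
proof -
  interpret sigma_finite_measure "lebesgue_Rn d" by (rule sigma_finite_lebesgue_Rn)
  have "AE x in lebesgue_Rn d. ennreal (p x) = RN_deriv (lebesgue_Rn d) (density (lebesgue_Rn d) (\<lambda>x. ennreal (p x))) x"
    using assms(1) by (intro RN_deriv_unique) auto
  with assms(2) show ?thesis
    by eventually_elim (simp add: leb_density_def, metis enn2real_ennreal)
qed

text \<open>
An upper bound for the integral of the positive part is enough, since the negative part is subtracted.
\<close>

lemma KL_le_integral_bound:
  fixes p q :: "(nat \<Rightarrow> real) \<Rightarrow> real"
  assumes [measurable]: "p \<in> borel_measurable (lebesgue_Rn d)" "q \<in> borel_measurable (lebesgue_Rn d)"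
    and pos: "AE x in lebesgue_Rn d. 0 < p x \<and> 0 < q x"
    and bound: "AE x in lebesgue_Rn d. ln (p x / q x) * p x \<le> s x"
    and B: "(\<integral>\<^sup>+x. ennreal (s x) \<partial>lebesgue_Rn d) \<le> ennreal B" "B \<ge> 0"
  shows "KL d (density (lebesgue_Rn d) (\<lambda>x. ennreal (p x))) (density (lebesgue_Rn d) (\<lambda>x. ennreal (q x))) \<le> ereal B"
proof -
  let ?M = "lebesgue_Rn d"
  let ?P = "density ?M (\<lambda>x. ennreal (p x))" and ?Q = "density ?M (\<lambda>x. ennreal (q x))"
  let ?k = "\<lambda>x. kl_integrand (leb_density d ?P x) (leb_density d ?Q x)"
  have "absolutely_continuous ?M ?P" "absolutely_continuous ?M ?Q"
    by (auto intro!: absolutely_continuousI_density)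
  then have KL: "KL d ?P ?Q = enn2ereal (\<integral>\<^sup>+x. e2ennreal (?k x) \<partial>?M) - enn2ereal (\<integral>\<^sup>+x. e2ennreal (- ?k x) \<partial>?M)"
    by (simp add: KL_def)
  have "AE x in ?M. 0 \<le> p x" "AE x in ?M. 0 \<le> q x"
    using pos by (eventually_elim, simp)+
  then have "AE x in ?M. leb_density d ?P x = p x" "AE x in ?M. leb_density d ?Q x = q x"
    by (simp_all add: AE_leb_density)
  then have "AE x in ?M. e2ennreal (?k x) \<le> ennreal (s x)"
    using pos bound by eventually_elim (auto simp: kl_integrand_def intro!: ennreal_leI)
  then have "(\<integral>\<^sup>+x. e2ennreal (?k x) \<partial>?M) \<le> ennreal B"
    by (rule order_trans[OF nn_integral_mono_AE B(1)])
  then have "enn2ereal (\<integral>\<^sup>+x. e2ennreal (?k x) \<partial>?M) \<le> ereal B"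
    using B(2) by (simp add: less_eq_ennreal.rep_eq enn2ereal_ennreal)
  moreover have "KL d ?P ?Q \<le> enn2ereal (\<integral>\<^sup>+x. e2ennreal (?k x) \<partial>?M) - 0"
    unfolding KL by (intro ereal_minus_mono order_refl enn2ereal_nonneg)
  ultimately show ?thesis by simp
qed

lemma abs_ln_diff_le:
  fixes a b c :: real
  assumes "c > 0" "a > c" "b > c"
  shows "\<bar>ln a - ln b\<bar> \<le> \<bar>a - b\<bar> / c"
proof -
  have *: "ln x - ln y \<le> \<bar>x - y\<bar> / c" if "x > c" "y > c" for x y :: real
  proof -
    have "ln x - ln y \<le> (x - y) / y" using that assms(1) by (intro ln_diff_le) auto
    also have "\<dots> \<le> \<bar>x - y\<bar> / y" using that assms(1) by (intro divide_right_mono) auto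
    also have "\<dots> \<le> \<bar>x - y\<bar> / c" using that assms(1) by (intro divide_left_mono) auto
    finally show ?thesis .
  qed
  show ?thesis using *[of a b] *[of b a] assms by (simp add: abs_le_iff abs_minus_commute)
qed

lemma ln_std_normal_density: "ln (std_normal_density t) = ln (1 / sqrt (2 * pi)) - t\<^sup>2 / 2"
  unfolding std_normal_density_def by (subst ln_mult_pos) simp_all

text \<open>
The Gaussian factors contribute \<open>b\<^sub>i\<^sup>2 - a\<^sub>i\<^sup>2 = -(a\<^sub>i - b\<^sub>i) (a\<^sub>i + b\<^sub>i)\<close>, and the logarithm is Lipschitz with constant
\<open>1/c\<close> beyond \<open>c\<close>.
\<close>

lemma abs_ln_density_ratio_le:
  assumes c: "c > 0" and fg: "\<And>i. i \<in> {1..d} \<Longrightarrow> f i > c" "\<And>i. i \<in> {1..d} \<Longrightarrow> g i > c"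
  shows "\<bar>ln ((gauss_density d a * (\<Prod>i\<in>{1..d}. f i)) / (gauss_density d b * (\<Prod>i\<in>{1..d}. g i)))\<bar>
    \<le> (\<Sum>i\<in>{1..d}. \<bar>(a i - b i) * (a i + b i)\<bar> / 2 + \<bar>f i - g i\<bar> / c)"
proof -
  have ln_p: "ln (gauss_density d x * (\<Prod>i\<in>{1..d}. h i)) = (\<Sum>i\<in>{1..d}. ln (1 / sqrt (2 * pi)) - (x i)\<^sup>2 / 2 + ln (h i))"
    and pos: "gauss_density d x * (\<Prod>i\<in>{1..d}. h i) > 0"
    if h: "\<And>i. i \<in> {1..d} \<Longrightarrow> h i > c" for h x
  proof -
    have h0: "0 < h i" if "i \<in> {1..d}" for i using h[OF that] c by linarith
    then have prod: "(\<Prod>i\<in>{1..d}. h i) > 0" by (intro prod_pos) auto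
    then show "gauss_density d x * (\<Prod>i\<in>{1..d}. h i) > 0" by (simp add: gauss_density_pos)
    have "ln (gauss_density d x) = (\<Sum>i\<in>{1..d}. ln (1 / sqrt (2 * pi)) - (x i)\<^sup>2 / 2)"
      unfolding gauss_density_def ln_std_normal_density[symmetric]
      by (rule ln_prod) (simp_all add: std_normal_density_def)
    moreover have "ln (\<Prod>i\<in>{1..d}. h i) = (\<Sum>i\<in>{1..d}. ln (h i))"
      by (rule ln_prod[OF finite_atLeastAtMost]) (rule less_imp_neq[OF h0, symmetric])
    ultimately show "ln (gauss_density d x * (\<Prod>i\<in>{1..d}. h i)) = (\<Sum>i\<in>{1..d}. ln (1 / sqrt (2 * pi)) - (x i)\<^sup>2 / 2 + ln (h i))"
      using prod gauss_density_pos[of d x] by (simp add: ln_mult_pos sum.distrib)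
  qed
  have "ln ((gauss_density d a * (\<Prod>i\<in>{1..d}. f i)) / (gauss_density d b * (\<Prod>i\<in>{1..d}. g i)))
      = ln (gauss_density d a * (\<Prod>i\<in>{1..d}. f i)) - ln (gauss_density d b * (\<Prod>i\<in>{1..d}. g i))"
    by (rule ln_divide_pos[OF pos[where h = f and x = a, OF fg(1)] pos[where h = g and x = b, OF fg(2)]])
  also have "ln (gauss_density d a * (\<Prod>i\<in>{1..d}. f i)) = (\<Sum>i\<in>{1..d}. ln (1 / sqrt (2 * pi)) - (a i)\<^sup>2 / 2 + ln (f i))"
    by (rule ln_p) (rule fg)
  also have "ln (gauss_density d b * (\<Prod>i\<in>{1..d}. g i)) = (\<Sum>i\<in>{1..d}. ln (1 / sqrt (2 * pi)) - (b i)\<^sup>2 / 2 + ln (g i))"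
    by (rule ln_p) (rule fg)
  finally have eq: "ln ((gauss_density d a * (\<Prod>i\<in>{1..d}. f i)) / (gauss_density d b * (\<Prod>i\<in>{1..d}. g i)))
      = (\<Sum>i\<in>{1..d}. (ln (1 / sqrt (2 * pi)) - (a i)\<^sup>2 / 2 + ln (f i)) - (ln (1 / sqrt (2 * pi)) - (b i)\<^sup>2 / 2 + ln (g i)))"
    by (simp only: sum_subtractf[symmetric])
  show ?thesis
    unfolding eq
  proof (rule order_trans[OF sum_abs sum_mono])
    fix i assume i: "i \<in> {1..d}"
    have "(ln (1 / sqrt (2 * pi)) - (a i)\<^sup>2 / 2 + ln (f i)) - (ln (1 / sqrt (2 * pi)) - (b i)\<^sup>2 / 2 + ln (g i))
        = - (((a i - b i) * (a i + b i)) / 2) + (ln (f i) - ln (g i))"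
      by (simp add: power2_eq_square algebra_simps diff_divide_distrib)
    also have "\<bar>\<dots>\<bar> \<le> \<bar>(a i - b i) * (a i + b i)\<bar> / 2 + \<bar>f i - g i\<bar> / c"
      using abs_ln_diff_le[OF c fg(1)[OF i] fg(2)[OF i]] by linarith
    finally show "\<bar>(ln (1 / sqrt (2 * pi)) - (a i)\<^sup>2 / 2 + ln (f i)) - (ln (1 / sqrt (2 * pi)) - (b i)\<^sup>2 / 2 + ln (g i))\<bar>
        \<le> \<bar>(a i - b i) * (a i + b i)\<bar> / 2 + \<bar>f i - g i\<bar> / c" .
  qed
qed

lemma Cauchy_Schwarz_integral:
  fixes u w :: "'a \<Rightarrow> real"
  assumes [measurable]: "u \<in> borel_measurable M" "w \<in> borel_measurable M"
    and int: "integrable M (\<lambda>x. (u x)\<^sup>2)" "integrable M (\<lambda>x. (w x)\<^sup>2)"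
  shows "integrable M (\<lambda>x. u x * w x)"
    and "(\<integral>x. \<bar>u x * w x\<bar> \<partial>M) \<le> sqrt (\<integral>x. (u x)\<^sup>2 \<partial>M) * sqrt (\<integral>x. (w x)\<^sup>2 \<partial>M)"
proof -
  show uw: "integrable M (\<lambda>x. u x * w x)"
  proof (rule Bochner_Integration.integrable_bound[OF Bochner_Integration.integrable_add[OF int]])
    have "norm (u x * w x) \<le> norm ((u x)\<^sup>2 + (w x)\<^sup>2)" for x
    proof -
      have "2 * \<bar>u x * w x\<bar> \<le> (u x)\<^sup>2 + (w x)\<^sup>2"
        using sum_squares_bound[of "\<bar>u x\<bar>" "\<bar>w x\<bar>"] by (simp add: abs_mult)
      then show ?thesis using abs_ge_zero[of "u x * w x"] unfolding real_norm_def by linarith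
    qed
    then show "AE x in M. norm (u x * w x) \<le> norm ((u x)\<^sup>2 + (w x)\<^sup>2)" by simp
  qed measurable
  have uw': "(\<integral>\<^sup>+x. ennreal \<bar>u x\<bar> * ennreal \<bar>w x\<bar> \<partial>M) = ennreal (\<integral>x. \<bar>u x * w x\<bar> \<partial>M)"
    using nn_integral_eq_integral[OF integrable_abs[OF uw]] by (simp add: ennreal_mult' [symmetric] abs_mult)
  have sq: "(\<integral>\<^sup>+x. (ennreal \<bar>h x\<bar>)\<^sup>2 \<partial>M) = ennreal (\<integral>x. (h x)\<^sup>2 \<partial>M)" if "integrable M (\<lambda>x. (h x)\<^sup>2)" for h :: "'a \<Rightarrow> real"
    using nn_integral_eq_integral[OF that] by (simp add: ennreal_power)
  have "(ennreal (\<integral>x. \<bar>u x * w x\<bar> \<partial>M))\<^sup>2 \<le> ennreal (\<integral>x. (u x)\<^sup>2 \<partial>M) * ennreal (\<integral>x. (w x)\<^sup>2 \<partial>M)"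
    using Cauchy_Schwarz_nn_integral[of "\<lambda>x. ennreal \<bar>u x\<bar>" M "\<lambda>x. ennreal \<bar>w x\<bar>"]
    by (simp add: uw' sq int)
  then have "(\<integral>x. \<bar>u x * w x\<bar> \<partial>M)\<^sup>2 \<le> (\<integral>x. (u x)\<^sup>2 \<partial>M) * (\<integral>x. (w x)\<^sup>2 \<partial>M)"
    by (simp add: ennreal_power ennreal_mult'[symmetric] ennreal_le_iff)
  from real_le_rsqrt[OF this]
  show "(\<integral>x. \<bar>u x * w x\<bar> \<partial>M) \<le> sqrt (\<integral>x. (u x)\<^sup>2 \<partial>M) * sqrt (\<integral>x. (w x)\<^sup>2 \<partial>M)"
    by (simp add: real_sqrt_mult)
qed

lemma integrable_square_add:
  fixes u w :: "'a \<Rightarrow> real"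
  assumes [measurable]: "u \<in> borel_measurable M" "w \<in> borel_measurable M"
    and int: "integrable M (\<lambda>x. (u x)\<^sup>2)" "integrable M (\<lambda>x. (w x)\<^sup>2)"
  shows "integrable M (\<lambda>x. (u x + w x)\<^sup>2)" "integrable M (\<lambda>x. (u x - w x)\<^sup>2)"
  using int Cauchy_Schwarz_integral(1)[OF assms] by (simp_all add: power2_sum power2_diff mult.assoc)

lemma L2_norm_le_V_norm: "L2_norm \<mu> v \<le> V_norm i \<mu> v"
  unfolding V_norm_def by (intro real_le_rsqrt) simp

lemma sqrt_integral_weak_pd_le_V_norm: "sqrt (\<integral>x. (weak_pd i i v x)\<^sup>2 \<partial>\<mu>) \<le> V_norm i \<mu> v"
  unfolding V_norm_def by simp

lemma V_norm_nonneg: "V_norm i \<mu> v \<ge> 0"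
  unfolding V_norm_def by simp

lemma V_space_std_gaussianD:
  assumes "v \<in> V_space i (std_gaussian i)"
  shows "v \<in> borel_measurable (lebesgue_Rn i)" "integrable (std_gaussian i) (\<lambda>y. (v y)\<^sup>2)"
    "has_weak_pd i i v (weak_pd i i v)" "weak_pd i i v \<in> borel_measurable (lebesgue_Rn i)"
    "integrable (std_gaussian i) (\<lambda>y. (weak_pd i i v y)\<^sup>2)"
  using assms by (auto simp: V_space_def L2_space_def intro: has_weak_pd_weak_pd)

text \<open>
The estimate with its explicit constant. The first summand of the constant comes from the Gaussian factors,
the second from the Jacobian determinants.
\<close>

lemma KL_pullback_le:
  assumes tri: "lower_triangular d F Fi" "lower_triangular d G Gi"
    and inv: "invertible_map d F" "invertible_map d G"
    and V: "\<And>i. i \<in> {1..d} \<Longrightarrow> Fi i \<in> V_space i (std_gaussian i)"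
      "\<And>i. i \<in> {1..d} \<Longrightarrow> Gi i \<in> V_space i (std_gaussian i)"
    and c: "c > 0" "\<And>i. i \<in> {1..d} \<Longrightarrow> AE y in lebesgue_Rn i. weak_pd i i (Fi i) y > c"
      "\<And>i. i \<in> {1..d} \<Longrightarrow> AE y in lebesgue_Rn i. weak_pd i i (Gi i) y > c"
    and bound: "AE x in lebesgue_Rn d. leb_density d (pullback d F (std_gaussian d)) x
      \<le> c\<^sub>F * leb_density d (std_gaussian d) x"
  shows "KL d (pullback d F (std_gaussian d)) (pullback d G (std_gaussian d))
    \<le> ereal (\<bar>c\<^sub>F\<bar> * (L2_norm_vec d (std_gaussian d) (\<lambda>x i. F x i + G x i) / 2 + 1 / c) *
        (\<Sum>i\<in>{1..d}. V_norm i (std_gaussian i) (\<lambda>y. Fi i y - Gi i y)))"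
proof -
  let ?M = "lebesgue_Rn d" and ?\<eta> = "std_gaussian d"
  interpret \<eta>: prob_space ?\<eta> by (rule prob_space_std_gaussian)
  define f where "f i = weak_pd i i (Fi i)" for i
  define g where "g i = weak_pd i i (Gi i)" for i
  define R where "R = L2_norm_vec d ?\<eta> (\<lambda>x i. F x i + G x i)"
  define V where "V i = V_norm i (std_gaussian i) (\<lambda>y. Fi i y - Gi i y)" for i
  define p where "p x = gauss_density d (F x) * (\<Prod>i\<in>{1..d}. f i (restrict x {1..i}))" for x
  define q where "q x = gauss_density d (G x) * (\<Prod>i\<in>{1..d}. g i (restrict x {1..i}))" for x
  define u where "u i x = Fi i (restrict x {1..i}) - Gi i (restrict x {1..i})" for i x
  define w where "w i x = Fi i (restrict x {1..i}) + Gi i (restrict x {1..i})" for i x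
  define h where "h i x = f i (restrict x {1..i}) - g i (restrict x {1..i})" for i x
  define S where "S x = (\<Sum>i\<in>{1..d}. \<bar>u i x * w i x\<bar> / 2 + \<bar>h i x\<bar> / c)" for x
  note VF = V_space_std_gaussianD[OF V(1)] and VG = V_space_std_gaussianD[OF V(2)]
  have weak: "has_weak_pd i i (Fi i) (f i)" "has_weak_pd i i (Gi i) (g i)" if "i \<in> {1..d}" for i
    using VF(3)[OF that] VG(3)[OF that] by (simp_all add: f_def g_def)
  have fc: "AE y in lebesgue_Rn i. f i y > c" and gc: "AE y in lebesgue_Rn i. g i y > c"
    if "i \<in> {1..d}" for i
    using c(2,3)[OF that] by (simp_all add: f_def g_def)
  have meas [measurable]: "(\<lambda>x. r (restrict x {1..i})) \<in> borel_measurable ?M"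
    if "i \<in> {1..d}" "r \<in> borel_measurable (lebesgue_Rn i)" for i and r :: "(nat \<Rightarrow> real) \<Rightarrow> real"
    using that by (intro measurable_compose[OF measurable_restrict_Rn]) auto
  have f_meas: "f i \<in> borel_measurable (lebesgue_Rn i)" and g_meas: "g i \<in> borel_measurable (lebesgue_Rn i)"
    if "i \<in> {1..d}" for i
    using VF(4)[OF that] VG(4)[OF that] by (simp_all add: f_def g_def)
  have u_meas: "u i \<in> borel_measurable ?M" and w_meas: "w i \<in> borel_measurable ?M" and h_meas: "h i \<in> borel_measurable ?M"
    if i: "i \<in> {1..d}" for i
    using meas[OF i VF(1)[OF i]] meas[OF i VG(1)[OF i]] meas[OF i f_meas[OF i]] meas[OF i g_meas[OF i]]
    unfolding u_def[abs_def] w_def[abs_def] h_def[abs_def] by (auto intro: borel_measurable_diff borel_measurable_add)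
  have FG_meas [measurable]: "F \<in> measurable ?M ?M" "G \<in> measurable ?M ?M"
    using inv by (auto simp: invertible_map_def)
  have p_meas: "p \<in> borel_measurable ?M" and q_meas: "q \<in> borel_measurable ?M"
    unfolding p_def[abs_def] q_def[abs_def]
    using meas[OF _ f_meas] meas[OF _ g_meas]
    by (intro borel_measurable_times borel_measurable_prod measurable_compose[OF FG_meas(1) gauss_density_measurable]
        measurable_compose[OF FG_meas(2) gauss_density_measurable]; simp)+
  have f_c: "AE x in ?M. \<forall>i\<in>{1..d}. f i (restrict x {1..i}) > c" by (rule AE_all_marginals_greater[OF f_meas fc])
  have g_c: "AE x in ?M. \<forall>i\<in>{1..d}. g i (restrict x {1..i}) > c" by (rule AE_all_marginals_greater[OF g_meas gc])
  have pos: "AE x in ?M. 0 < p x \<and> 0 < q x"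
    using f_c g_c
  proof eventually_elim
    fix x assume f: "\<forall>i\<in>{1..d}. f i (restrict x {1..i}) > c" and g: "\<forall>i\<in>{1..d}. g i (restrict x {1..i}) > c"
    have "0 < (\<Prod>i\<in>{1..d}. f i (restrict x {1..i}))" "0 < (\<Prod>i\<in>{1..d}. g i (restrict x {1..i}))"
      by (rule prod_pos, use f g c(1) less_trans in blast)+
    then show "0 < p x \<and> 0 < q x" by (simp add: p_def q_def gauss_density_pos)
  qed
  have pull_F: "pullback d F ?\<eta> = density ?M (\<lambda>x. ennreal (p x))"
    unfolding p_def using tri(1) inv(1) weak(1) c(1) fc by (rule pullback_std_gaussian)
  have pull_G: "pullback d G ?\<eta> = density ?M (\<lambda>x. ennreal (q x))"
    unfolding q_def using tri(2) inv(2) weak(2) c(1) gc by (rule pullback_std_gaussian)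
  have p_le: "AE x in ?M. p x \<le> \<bar>c\<^sub>F\<bar> * gauss_density d x"
  proof -
    have "AE x in ?M. 0 \<le> p x" using pos by eventually_elim simp
    then have "AE x in ?M. leb_density d (pullback d F ?\<eta>) x = p x"
      unfolding pull_F by (rule AE_leb_density[OF p_meas])
    moreover have "AE x in ?M. leb_density d ?\<eta> x = gauss_density d x"
      unfolding std_gaussian_eq_density
      by (rule AE_leb_density) (simp_all add: less_imp_le gauss_density_pos)
    ultimately show ?thesis using bound
    proof eventually_elim
      fix x assume "leb_density d (pullback d F ?\<eta>) x = p x" "leb_density d ?\<eta> x = gauss_density d x"
        "leb_density d (pullback d F ?\<eta>) x \<le> c\<^sub>F * leb_density d ?\<eta> x"
      then have "p x \<le> c\<^sub>F * gauss_density d x" by simp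
      also have "c\<^sub>F * gauss_density d x \<le> \<bar>c\<^sub>F\<bar> * gauss_density d x"
        by (intro mult_right_mono) (simp_all add: less_imp_le gauss_density_pos)
      finally show "p x \<le> \<bar>c\<^sub>F\<bar> * gauss_density d x" .
    qed
  qed
  have FG_comp: "F x i = Fi i (restrict x {1..i})" "G x i = Gi i (restrict x {1..i})"
    if "x \<in> Rn d" "i \<in> {1..d}" for x i
    using tri that unfolding lower_triangular_def by auto
  have S_nonneg: "S x \<ge> 0" for x
    unfolding S_def using c(1) by (intro sum_nonneg add_nonneg_nonneg divide_nonneg_nonneg) auto
  have log_bound: "AE x in ?M. ln (p x / q x) * p x \<le> gauss_density d x * (\<bar>c\<^sub>F\<bar> * S x)"
    using f_c g_c pos p_le AE_space
  proof eventually_elim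
    fix x assume f: "\<forall>i\<in>{1..d}. f i (restrict x {1..i}) > c" and g: "\<forall>i\<in>{1..d}. g i (restrict x {1..i}) > c"
      and pq: "0 < p x \<and> 0 < q x" and px: "p x \<le> \<bar>c\<^sub>F\<bar> * gauss_density d x" and "x \<in> space ?M"
    then have x: "x \<in> Rn d" by simp
    have "\<bar>ln (p x / q x)\<bar> \<le> (\<Sum>i\<in>{1..d}. \<bar>(F x i - G x i) * (F x i + G x i)\<bar> / 2
        + \<bar>f i (restrict x {1..i}) - g i (restrict x {1..i})\<bar> / c)"
      unfolding p_def q_def using f g by (intro abs_ln_density_ratio_le[OF c(1)]) blast+
    also have "\<dots> = S x"
      unfolding S_def by (intro sum.cong refl) (simp add: u_def w_def h_def FG_comp[OF x])
    finally have "ln (p x / q x) \<le> S x" by simp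
    then have "ln (p x / q x) * p x \<le> S x * p x" using pq by (intro mult_right_mono) auto
    also have "\<dots> \<le> S x * (\<bar>c\<^sub>F\<bar> * gauss_density d x)" by (intro mult_left_mono px S_nonneg)
    finally show "ln (p x / q x) * p x \<le> gauss_density d x * (\<bar>c\<^sub>F\<bar> * S x)" by (simp add: mult_ac)
  qed
  have R_eq: "R = sqrt (\<integral>x. (\<Sum>i\<in>{1..d}. (w i x)\<^sup>2) \<partial>?\<eta>)"
    unfolding R_def L2_norm_vec_def
    by (intro arg_cong[where f = sqrt] Bochner_Integration.integral_cong refl sum.cong) (simp add: w_def FG_comp)
  have sq: "integrable (std_gaussian i) (\<lambda>y. (Fi i y + Gi i y)\<^sup>2)" "integrable (std_gaussian i) (\<lambda>y. (Fi i y - Gi i y)\<^sup>2)"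
    "integrable (std_gaussian i) (\<lambda>y. (f i y - g i y)\<^sup>2)" if "i \<in> {1..d}" for i
    using VF(1,2,4,5)[OF that] VG(1,2,4,5)[OF that] unfolding f_def g_def
    by (auto intro!: integrable_square_add)
  have comp: "integrable ?\<eta> (\<lambda>x. (w i x)\<^sup>2)" "integrable ?\<eta> (\<lambda>x. (u i x)\<^sup>2)" "integrable ?\<eta> (\<lambda>x. (h i x)\<^sup>2)"
    "sqrt (\<integral>x. (u i x)\<^sup>2 \<partial>?\<eta>) \<le> V i" "sqrt (\<integral>x. (h i x)\<^sup>2 \<partial>?\<eta>) \<le> V i" if i: "i \<in> {1..d}" for i
  proof -
    have id: "i \<le> d" using i by simp
    note [measurable] = VF(1)[OF i] VG(1)[OF i] f_meas[OF i] g_meas[OF i]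
    have m: "(\<lambda>y. (Fi i y + Gi i y)\<^sup>2) \<in> borel_measurable (lebesgue_Rn i)"
      "(\<lambda>y. (Fi i y - Gi i y)\<^sup>2) \<in> borel_measurable (lebesgue_Rn i)"
      "(\<lambda>y. (f i y - g i y)\<^sup>2) \<in> borel_measurable (lebesgue_Rn i)" by measurable
    show "integrable ?\<eta> (\<lambda>x. (w i x)\<^sup>2)" "integrable ?\<eta> (\<lambda>x. (u i x)\<^sup>2)" "integrable ?\<eta> (\<lambda>x. (h i x)\<^sup>2)"
      using integrable_marginal[OF id m(1)] integrable_marginal[OF id m(2)] integrable_marginal[OF id m(3)] sq[OF i]
      unfolding w_def u_def h_def by blast+
    have "sqrt (\<integral>x. (u i x)\<^sup>2 \<partial>?\<eta>) = L2_norm (std_gaussian i) (\<lambda>y. Fi i y - Gi i y)"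
      using integral_marginal[OF id m(2)] by (simp add: u_def L2_norm_def)
    then show "sqrt (\<integral>x. (u i x)\<^sup>2 \<partial>?\<eta>) \<le> V i" by (simp add: V_def L2_norm_le_V_norm)
    have "AE y in lebesgue_Rn i. weak_pd i i (\<lambda>y. Fi i y - Gi i y) y = f i y - g i y"
      unfolding f_def g_def using i by (intro AE_weak_pd_diff[OF _ weak(1)[OF i] weak(2)[OF i]]) simp
    then have "AE y in std_gaussian i. (f i y - g i y)\<^sup>2 = (weak_pd i i (\<lambda>y. Fi i y - Gi i y) y)\<^sup>2"
      unfolding AE_std_gaussian_iff by eventually_elim simp
    moreover have "has_weak_pd i i (\<lambda>y. Fi i y - Gi i y) (weak_pd i i (\<lambda>y. Fi i y - Gi i y))"
      using i by (intro has_weak_pd_weak_pd[OF has_weak_pd_diff[OF _ weak(1)[OF i] weak(2)[OF i]]]) simp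
    then have "weak_pd i i (\<lambda>y. Fi i y - Gi i y) \<in> borel_measurable (lebesgue_Rn i)"
      by (auto simp: has_weak_pd_def intro: locally_integrable_measurable)
    ultimately have "(\<integral>y. (f i y - g i y)\<^sup>2 \<partial>std_gaussian i) = (\<integral>y. (weak_pd i i (\<lambda>y. Fi i y - Gi i y) y)\<^sup>2 \<partial>std_gaussian i)"
      by (intro integral_cong_AE) simp_all
    then have "sqrt (\<integral>x. (h i x)\<^sup>2 \<partial>?\<eta>) = sqrt (\<integral>y. (weak_pd i i (\<lambda>y. Fi i y - Gi i y) y)\<^sup>2 \<partial>std_gaussian i)"
      using integral_marginal[OF id m(3)] by (simp add: h_def)
    then show "sqrt (\<integral>x. (h i x)\<^sup>2 \<partial>?\<eta>) \<le> V i"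
      using sqrt_integral_weak_pd_le_V_norm by (simp add: V_def)
  qed
  have R_nonneg: "R \<ge> 0" unfolding R_def L2_norm_vec_def by (simp add: sum_nonneg)
  have V_nonneg: "V i \<ge> 0" for i by (simp add: V_def V_norm_nonneg)
  have w_le: "sqrt (\<integral>x. (w i x)\<^sup>2 \<partial>?\<eta>) \<le> R" if i: "i \<in> {1..d}" for i
    unfolding R_eq
  proof (intro real_sqrt_le_mono integral_mono)
    show "integrable ?\<eta> (\<lambda>x. (w i x)\<^sup>2)" by (rule comp(1)[OF i])
    show "integrable ?\<eta> (\<lambda>x. \<Sum>i\<in>{1..d}. (w i x)\<^sup>2)" by (intro Bochner_Integration.integrable_sum comp(1))
    show "(w i x)\<^sup>2 \<le> (\<Sum>i\<in>{1..d}. (w i x)\<^sup>2)" for x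
      using i by (intro member_le_sum[of i _ "\<lambda>i. (w i x)\<^sup>2"]) auto
  qed
  have uw: "integrable ?\<eta> (\<lambda>x. \<bar>u i x * w i x\<bar>)" "(\<integral>x. \<bar>u i x * w i x\<bar> \<partial>?\<eta>) \<le> V i * R"
    and hh: "integrable ?\<eta> (\<lambda>x. \<bar>h i x\<bar>)" "(\<integral>x. \<bar>h i x\<bar> \<partial>?\<eta>) \<le> V i" if i: "i \<in> {1..d}" for i
  proof -
    have m: "u i \<in> borel_measurable ?\<eta>" "w i \<in> borel_measurable ?\<eta>" "h i \<in> borel_measurable ?\<eta>"
      "(\<lambda>_. 1) \<in> borel_measurable ?\<eta>"
      using u_meas[OF i] w_meas[OF i] h_meas[OF i] by simp_all
    note CS1 = Cauchy_Schwarz_integral[OF m(1,2) comp(2,1)[OF i]]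
    show "integrable ?\<eta> (\<lambda>x. \<bar>u i x * w i x\<bar>)" by (rule integrable_abs[OF CS1(1)])
    show "(\<integral>x. \<bar>u i x * w i x\<bar> \<partial>?\<eta>) \<le> V i * R"
      by (rule order_trans[OF CS1(2)]) (intro mult_mono comp(4)[OF i] w_le[OF i] V_nonneg, simp)
    \<comment> \<open>On a probability space the mean of a function is bounded by its quadratic mean.\<close>
    have one: "integrable ?\<eta> (\<lambda>x. (1::real)\<^sup>2)" by simp
    note CS2 = Cauchy_Schwarz_integral[OF m(3,4) comp(3)[OF i] one]
    show "integrable ?\<eta> (\<lambda>x. \<bar>h i x\<bar>)" using integrable_abs[OF CS2(1)] by simp
    have "\<eta>.prob (Rn d) = 1" using \<eta>.prob_space by simp
    then show "(\<integral>x. \<bar>h i x\<bar> \<partial>?\<eta>) \<le> V i" using CS2(2) comp(5)[OF i] by simp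
  qed
  have S_int: "integrable ?\<eta> S"
    unfolding S_def[abs_def]
    by (intro Bochner_Integration.integrable_sum Bochner_Integration.integrable_add integrable_divide uw(1) hh(1))
  have "(\<integral>x. S x \<partial>?\<eta>) = (\<Sum>i\<in>{1..d}. (\<integral>x. \<bar>u i x * w i x\<bar> \<partial>?\<eta>) / 2 + (\<integral>x. \<bar>h i x\<bar> \<partial>?\<eta>) / c)"
    unfolding S_def using uw(1) hh(1)
    by (subst Bochner_Integration.integral_sum) (auto intro!: sum.cong)
  also have "\<dots> \<le> (\<Sum>i\<in>{1..d}. V i * R / 2 + V i / c)"
    using uw(2) hh(2) c(1) by (intro sum_mono add_mono divide_right_mono) auto
  also have "\<dots> = (R / 2 + 1 / c) * (\<Sum>i\<in>{1..d}. V i)"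
    by (subst sum_distrib_left) (intro sum.cong refl, simp add: algebra_simps)
  finally have S_le: "(\<integral>x. S x \<partial>?\<eta>) \<le> (R / 2 + 1 / c) * (\<Sum>i\<in>{1..d}. V i)" .
  define B where "B = \<bar>c\<^sub>F\<bar> * (R / 2 + 1 / c) * (\<Sum>i\<in>{1..d}. V i)"
  have B_nonneg: "B \<ge> 0"
    unfolding B_def using R_nonneg V_nonneg c(1) by (intro mult_nonneg_nonneg sum_nonneg) auto
  have S_meas: "S \<in> borel_measurable ?M" using borel_measurable_integrable[OF S_int] by simp
  have "(\<integral>\<^sup>+x. ennreal (gauss_density d x * (\<bar>c\<^sub>F\<bar> * S x)) \<partial>?M)
      = (\<integral>\<^sup>+x. ennreal (gauss_density d x) * ennreal (\<bar>c\<^sub>F\<bar> * S x) \<partial>?M)"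
    by (intro nn_integral_cong ennreal_mult') (simp add: less_imp_le gauss_density_pos)
  also have "\<dots> = (\<integral>\<^sup>+x. ennreal (\<bar>c\<^sub>F\<bar> * S x) \<partial>?\<eta>)"
    unfolding std_gaussian_eq_density by (rule nn_integral_density[symmetric]) (use S_meas in measurable)
  also have "\<dots> = ennreal (\<integral>x. \<bar>c\<^sub>F\<bar> * S x \<partial>?\<eta>)"
    using S_int S_nonneg by (intro nn_integral_eq_integral) auto
  also have "\<dots> \<le> ennreal B"
    using mult_left_mono[OF S_le, of "\<bar>c\<^sub>F\<bar>"] by (intro ennreal_leI) (simp add: B_def mult.assoc)
  finally have "(\<integral>\<^sup>+x. ennreal (gauss_density d x * (\<bar>c\<^sub>F\<bar> * S x)) \<partial>?M) \<le> ennreal B" .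
  then have "KL d (pullback d F ?\<eta>) (pullback d G ?\<eta>) \<le> ereal B"
    unfolding pull_F pull_G using p_meas q_meas pos log_bound B_nonneg by (intro KL_le_integral_bound)
  then show ?thesis unfolding B_def R_def V_def .
qed

theorem theorem4p9:
  shows "\<exists>C :: real \<Rightarrow> real \<Rightarrow> real \<Rightarrow> real. (\<forall>a b r. C a b r > 0) \<and>
    (\<forall>(d :: nat) (F :: (nat \<Rightarrow> real) \<Rightarrow> (nat \<Rightarrow> real)) (G :: (nat \<Rightarrow> real) \<Rightarrow> (nat \<Rightarrow> real))
        (Fi :: nat \<Rightarrow> (nat \<Rightarrow> real) \<Rightarrow> real) (Gi :: nat \<Rightarrow> (nat \<Rightarrow> real) \<Rightarrow> real)
        (c :: real) (c\<^sub>F :: real).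
      lower_triangular d F Fi \<longrightarrow> lower_triangular d G Gi \<longrightarrow>
      invertible_map d F \<longrightarrow> invertible_map d G \<longrightarrow>
      (\<forall>i \<in> {1..d}. Fi i \<in> V_space i (marginal i (std_gaussian d)) \<and>
                    Gi i \<in> V_space i (marginal i (std_gaussian d))) \<longrightarrow>
      c > 0 \<longrightarrow>
      (\<forall>i \<in> {1..d}. AE x in std_gaussian d.
          weak_pd i i (Fi i) (restrict x {1..i}) > c \<and>
          weak_pd i i (Gi i) (restrict x {1..i}) > c) \<longrightarrow>
      (AE x in lebesgue_Rn d.
          leb_density d (pullback d F (std_gaussian d)) x
            \<le> c\<^sub>F * leb_density d (std_gaussian d) x) \<longrightarrow>
      KL d (pullback d F (std_gaussian d)) (pullback d G (std_gaussian d))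
        \<le> ereal (C c\<^sub>F c (L2_norm_vec d (std_gaussian d) (\<lambda>x i. F x i + G x i)) *
            (\<Sum>i = 1..d. V_norm i (marginal i (std_gaussian d)) (\<lambda>y. Fi i y - Gi i y))))"
\<comment> \<open>Absolute values and the added one make the constant positive at all real arguments.\<close>
proof (intro exI[of _ "\<lambda>a b r. \<bar>a\<bar> * (\<bar>r\<bar> / 2 + 1 / \<bar>b\<bar>) + 1"] conjI allI impI)
  show "\<bar>a\<bar> * (\<bar>r\<bar> / 2 + 1 / \<bar>b\<bar>) + 1 > 0" for a b r :: real
    by (intro add_nonneg_pos mult_nonneg_nonneg add_nonneg_nonneg) auto
next
  fix d F G Fi Gi and c c\<^sub>F :: real
  assume tri: "lower_triangular d F Fi" "lower_triangular d G Gi"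
    and inv: "invertible_map d F" "invertible_map d G"
    and V: "\<forall>i \<in> {1..d}. Fi i \<in> V_space i (marginal i (std_gaussian d)) \<and>
                    Gi i \<in> V_space i (marginal i (std_gaussian d))"
    and c: "c > 0"
    and D2: "\<forall>i \<in> {1..d}. AE x in std_gaussian d.
          weak_pd i i (Fi i) (restrict x {1..i}) > c \<and>
          weak_pd i i (Gi i) (restrict x {1..i}) > c"
    and D3: "AE x in lebesgue_Rn d. leb_density d (pullback d F (std_gaussian d)) x
            \<le> c\<^sub>F * leb_density d (std_gaussian d) x"
  let ?R = "L2_norm_vec d (std_gaussian d) (\<lambda>x i. F x i + G x i)"
  let ?V = "\<lambda>i. V_norm i (std_gaussian i) (\<lambda>y. Fi i y - Gi i y)"
  have V': "Fi i \<in> V_space i (std_gaussian i)" "Gi i \<in> V_space i (std_gaussian i)" if "i \<in> {1..d}" for i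
    using V that by (auto simp: marginal_std_gaussian)
  have D2': "AE y in lebesgue_Rn i. weak_pd i i v y > c"
    if i: "i \<in> {1..d}" and v: "v \<in> V_space i (std_gaussian i)"
      and AE: "AE x in std_gaussian d. weak_pd i i v (restrict x {1..i}) > c" for i v
  proof -
    note [measurable] = V_space_std_gaussianD(4)[OF v]
    have "{y \<in> space (lebesgue_Rn i). weak_pd i i v y > c} \<in> sets (lebesgue_Rn i)" by measurable
    then show ?thesis using AE_marginal_iff[of i d "\<lambda>y. weak_pd i i v y > c"] AE i by simp
  qed
  have "KL d (pullback d F (std_gaussian d)) (pullback d G (std_gaussian d))
      \<le> ereal (\<bar>c\<^sub>F\<bar> * (?R / 2 + 1 / c) * (\<Sum>i\<in>{1..d}. ?V i))"
  proof (rule KL_pullback_le[OF tri inv V' c _ _ D3])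
    fix i assume i: "i \<in> {1..d}"
    have "AE x in std_gaussian d. weak_pd i i (Fi i) (restrict x {1..i}) > c"
      "AE x in std_gaussian d. weak_pd i i (Gi i) (restrict x {1..i}) > c"
      using bspec[OF D2 i] by (eventually_elim, simp)+
    then show "AE y in lebesgue_Rn i. weak_pd i i (Fi i) y > c" "AE y in lebesgue_Rn i. weak_pd i i (Gi i) y > c"
      using D2'[OF i V'(1)[OF i]] D2'[OF i V'(2)[OF i]] by blast+
  qed
  also have "\<bar>c\<^sub>F\<bar> * (?R / 2 + 1 / c) * (\<Sum>i\<in>{1..d}. ?V i)
      \<le> (\<bar>c\<^sub>F\<bar> * (\<bar>?R\<bar> / 2 + 1 / \<bar>c\<bar>) + 1) * (\<Sum>i\<in>{1..d}. ?V i)"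
  proof (rule mult_right_mono)
    have "\<bar>c\<^sub>F\<bar> * (?R / 2 + 1 / c) \<le> \<bar>c\<^sub>F\<bar> * (\<bar>?R\<bar> / 2 + 1 / \<bar>c\<bar>)"
      using c by (intro mult_left_mono) auto
    then show "\<bar>c\<^sub>F\<bar> * (?R / 2 + 1 / c) \<le> \<bar>c\<^sub>F\<bar> * (\<bar>?R\<bar> / 2 + 1 / \<bar>c\<bar>) + 1" by linarith
  qed (intro sum_nonneg V_norm_nonneg)
  also have "(\<Sum>i\<in>{1..d}. ?V i) = (\<Sum>i = 1..d. V_norm i (marginal i (std_gaussian d)) (\<lambda>y. Fi i y - Gi i y))"
    by (intro sum.cong refl) (simp add: marginal_std_gaussian)
  finally show "KL d (pullback d F (std_gaussian d)) (pullback d G (std_gaussian d))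
      \<le> ereal ((\<bar>c\<^sub>F\<bar> * (\<bar>?R\<bar> / 2 + 1 / \<bar>c\<bar>) + 1) *
          (\<Sum>i = 1..d. V_norm i (marginal i (std_gaussian d)) (\<lambda>y. Fi i y - Gi i y)))"
    by simp
qed

end
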